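(* Let $\Gamma$ be a space group in $\mathbb{R}^d$ with a generic lattice, let $(G=(V,E),\psi)$ be a finite $\Gamma$-gain graph, let $k=\dim_{\mathbb{R}}\overline{\mathrm{Lat}}(\Gamma)$, and define $$h_\Gamma(F)=d|V(F)|-d\,c(F)+\dim_{\mathbb{R}}\operatorname{span}\{U_{e,\psi_F^\circ}\mid e\in E(G_F^\circ)\}-1\qquad(F\subseteq E).$$ Then for almost all $p:V\to\mathbb{R}^d$, $\dim_{\mathbb{R}}\operatorname{span}\{P'_{e,\psi}(p)\mid e\in E\}=\hat h_\Gamma(E)$.
   Context: A space group $\Gamma$ is a discrete cocompact subgroup of the Euclidean group; $\gamma=(A_\gamma,t_\gamma)$ with $A_\gamma$ orthogonal acts by $q\mapsto A_\gamma q+t_\gamma$, and $(A,t)(A',t')=(AA',At'+t)$. Its translations form a lattice generated by linearly independent $t_1,\dots,t_d$; $B_\Gamma$ is the matrix with columns $t_1,\dots,t_d$. Each $\gamma$ has standard form $K_\gamma=B_\Gamma^{-1}A_\gamma B_\Gamma\in GL(\mathbb{Z}^d)$, $t_\gamma=B_\Gamma(z_\gamma+c_\gamma)$, $z_\gamma\in\mathbb{Z}^d$, $c_\gamma\in[0,1)^d$. $\Gamma_1=\{A_\gamma\}$; $\mathbb{Q}_{\Gamma_1}$ is the field generated by $\mathbb{Q}$ and the entries of matrices in $\Gamma_1$. $\overline{\mathrm{Lat}}(\Gamma)=\{B\in\mathbb{R}^{d\times d}:BK_\gamma=A_\gamma B\ \forall\gamma\}$; fix a basis $B_1,\dots,B_k$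 of it. The lattice is generic if $B_\Gamma=\sum_i s_iB_i$ with $s_1,\dots,s_k$ algebraically independent over $\mathbb{Q}_{\Gamma_1}$. Let $b:\mathbb{R}^d\times\mathbb{R}^d\to\mathbb{R}^k$, $b(\alpha,t)=(\langle\alpha,B_iB_\Gamma^{-1}t\rangle)_{i=1}^k$. $\Gamma$-gain graph: $G$ finite directed (loops, parallel edges allowed), $\psi:E\to\Gamma$, $\psi(e)=\psi_e=(A_{\psi_e},t_{\psi_e})$, reversing an edge inverts its gain. $V(F)$ = endvertices; $c(F)$ = number of components of $(V(F),F)$. Switching at $v$ with $\gamma$: non-loop edges out of $v$ get $\gamma\psi(e)$, into $v$ get $\psi(e)\gamma^{-1}$, loops at $v$ get $\gamma\psi(e)\gamma^{-1}$. Compressed graph $(G_F^\circ,\psi_F^\circ)$: take a maximal forest $T$ of $F$ and a gain function $\psi_F^\circ$ obtained from $\psi$ by switchings that is the identity on $T$; contract each component of $(V(F),F)$ to a vertex, edges of $F$ becoming loops with gains $\psi_F^\circ(e)$. For a gain graph with vertex set $W$ and gains $\phi_e=(A_{\phi_e},t_{\phi_e})$, in $(\mathbb{R}^d)^W\oplus\mathbb{R}^k$ ($x(\ast)$ the $\mathbb{R}^k$-part): non-loop $e$ from $i$ to $j$: $U_{e,\phi}=\{x:x(i)+A_{\phi_e}x(j)=0,\ b(x(i),t_{\phi_e})+x(\ast)=0,\ x(w)=0\ \forall w\ne i,j\}$; loop $e$ at $i$: $U_{e,\phi}=\{x:\exists\alpha,\ x(i)=(I_d-A_{\phi_e})\alpha,\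 x(\ast)=-b(\alpha,t_{\phi_e}),\ x(w)=0\ \forall w\ne i\}$. For $e$ from $i$ to $j$ in $G$ (possibly $i=j$): $P'_{e,\psi}(p)=U_{e,\psi}\cap\{x:\langle p(i)-(A_{\psi_e}p(j)+t_{\psi_e}),x(i)\rangle=0\}$. Dilworth truncation: $F_+=\{e\in F:h(\{e\})\ge0\}$, $\hat h(F)=\min\sum_i h(F_i)$ over partitions of $F_+$ into nonempty parts, $\hat h(F)=0$ if $F_+=\emptyset$.
   Formalization: For loops the formulas are corrected, since the claim is false as printed: U has block x(i)=(I−A^{-1})α instead of (I−A)α, and P' requires ⟨p(i)−(A p(i)+t), α⟩=0 instead of ⟨p(i)−(A p(i)+t), x(i)⟩=0. *)

theory Defs
  imports "HOL-Analysis.Analysis" "HOL-Algebra.Group"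
begin

section \<open>Space groups\<close>

text \<open>The isometry \<open>q \<mapsto> A q + t\<close> is the pair \<open>(A, t)\<close>. The dimension \<open>d\<close> is \<open>CARD('n)\<close>.\<close>

type_synonym 'n isometry = "(real^'n^'n) \<times> (real^'n)"

definition euclidean_group :: "'n::finite isometry monoid" where
  "euclidean_group =
     \<lparr>carrier = {g. orthogonal_matrix (fst g)},
      monoid.mult = (\<lambda>g h. (fst g ** fst h, fst g *v snd h + snd g)),
      one = (mat 1, 0)\<rparr>"

lemma group_euclidean_group: "group (euclidean_group :: 'n::finite isometry monoid)"
proof (rule groupI)
  fix x :: "'n isometry" assume x: "x \<in> carrier euclidean_group"
  show "\<exists>y\<in>carrier euclidean_group. y \<otimes>\<^bsub>euclidean_group\<^esub> x = \<one>\<^bsub>euclidean_group\<^esub>"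
    by (rule bexI[of _ "(transpose (fst x), - (transpose (fst x) *v snd x))"])
       (use x in \<open>simp_all add: euclidean_group_def orthogonal_matrix_def\<close>)
qed (auto simp: euclidean_group_def orthogonal_matrix_mul orthogonal_matrix_id matrix_mul_assoc
        matrix_vector_mul_assoc matrix_vector_right_distrib)

lemma inv_euclidean_group:
  fixes A :: "real^'n::finite^'n"
  assumes "orthogonal_matrix A"
  shows "inv\<^bsub>euclidean_group\<^esub> (A, t) = (transpose A, - (transpose A *v t))"
  by (rule group.inv_equality[OF group_euclidean_group])
     (use assms in \<open>simp_all add: euclidean_group_def orthogonal_matrix_def\<close>)

text \<open>Cocompactness of \<open>\<Gamma>\<close>: some compact set of isometries meets every coset \<open>\<Gamma> g\<close>.\<close>

definition space_group :: "'n::finite isometry set \<Rightarrow> bool" where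
  "space_group \<Gamma> \<longleftrightarrow>
     subgroup \<Gamma> euclidean_group \<and> discrete \<Gamma> \<and>
     (\<exists>K \<subseteq> carrier euclidean_group. compact K \<and>
        (\<forall>g \<in> carrier euclidean_group. \<exists>\<gamma>\<in>\<Gamma>. \<exists>\<kappa>\<in>K. g = \<gamma> \<otimes>\<^bsub>euclidean_group\<^esub> \<kappa>))"

text \<open>The columns of \<open>B\<close> are linearly independent generators of the lattice of translations.\<close>

definition lattice_basis :: "'n::finite isometry set \<Rightarrow> real^'n^'n \<Rightarrow> bool" where
  "lattice_basis \<Gamma> B \<longleftrightarrow>
     invertible B \<and> {t. (mat 1, t) \<in> \<Gamma>} = {B *v z | z. \<forall>i. z $ i \<in> \<int>}"

definition std_matrix :: "real^'n^'n \<Rightarrow> 'n::finite isometry \<Rightarrow> real^'n^'n" where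
  "std_matrix B\<^sub>\<Gamma> \<gamma> = matrix_inv B\<^sub>\<Gamma> ** fst \<gamma> ** B\<^sub>\<Gamma>"

definition Lat_bar :: "'n::finite isometry set \<Rightarrow> real^'n^'n \<Rightarrow> (real^'n^'n) set" where
  "Lat_bar \<Gamma> B\<^sub>\<Gamma> = {B. \<forall>\<gamma>\<in>\<Gamma>. B ** std_matrix B\<^sub>\<Gamma> \<gamma> = fst \<gamma> ** B}"

definition basis_of :: "('k \<Rightarrow> 'a::real_vector) \<Rightarrow> 'a set \<Rightarrow> bool" where
  "basis_of b S \<longleftrightarrow> inj b \<and> independent (range b) \<and> span (range b) = S"

definition real_subfield :: "real set \<Rightarrow> bool" where
  "real_subfield K \<longleftrightarrow> 0 \<in> K \<and> 1 \<in> K \<and>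
     (\<forall>x\<in>K. \<forall>y\<in>K. x + y \<in> K \<and> x * y \<in> K) \<and> (\<forall>x\<in>K. - x \<in> K \<and> inverse x \<in> K)"

definition point_group_field :: "'n::finite isometry set \<Rightarrow> real set" where
  "point_group_field \<Gamma> = real_subfield hull (\<rat> \<union> {fst \<gamma> $ i $ j | \<gamma> i j. \<gamma> \<in> \<Gamma>})"

text \<open>The polynomial has exponent vectors \<open>m \<in> M\<close> and coefficients \<open>c m \<in> K\<close>.\<close>

definition alg_independent_over :: "real set \<Rightarrow> ('k::finite \<Rightarrow> real) \<Rightarrow> bool" where
  "alg_independent_over K s \<longleftrightarrow>
     (\<forall>(M :: ('k \<Rightarrow> nat) set) c. finite M \<longrightarrow> (\<forall>m\<in>M. c m \<in> K) \<longrightarrow>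
        (\<Sum>m\<in>M. c m * (\<Prod>i\<in>UNIV. s i ^ m i)) = 0 \<longrightarrow> (\<forall>m\<in>M. c m = 0))"

definition generic_lattice ::
    "'n::finite isometry set \<Rightarrow> real^'n^'n \<Rightarrow> ('k::finite \<Rightarrow> real^'n^'n) \<Rightarrow> bool" where
  "generic_lattice \<Gamma> B\<^sub>\<Gamma> Bs \<longleftrightarrow>
     (\<exists>s. B\<^sub>\<Gamma> = (\<Sum>i\<in>UNIV. s i *\<^sub>R Bs i) \<and> alg_independent_over (point_group_field \<Gamma>) s)"

definition b_map ::
    "('k::finite \<Rightarrow> real^'n^'n) \<Rightarrow> real^'n^'n \<Rightarrow> real^'n \<Rightarrow> real^'n \<Rightarrow> real^'k" where
  "b_map Bs B\<^sub>\<Gamma> \<alpha> t = (\<chi> i. \<alpha> \<bullet> ((Bs i ** matrix_inv B\<^sub>\<Gamma>) *v t))"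

section \<open>The subspaces attached to edges\<close>

text \<open>
  An element \<open>x\<close> of \<open>(\<real>\<^sup>d)\<^sup>W \<oplus> \<real>\<^sup>k\<close> is a pair: \<open>x(w)\<close> is \<open>fst x $ w\<close> and \<open>x(*)\<close> is \<open>snd x\<close>.
\<close>

definition vanishes_off :: "'w set \<Rightarrow> (real^'n^'w) \<times> (real^'k) \<Rightarrow> bool" where
  "vanishes_off S x \<longleftrightarrow> (\<forall>w. w \<notin> S \<longrightarrow> fst x $ w = 0)"

text \<open>
  The vector contributed by a loop at \<open>i\<close> with gain \<open>(A, t)\<close> and parameter \<open>\<alpha>\<close>: it is obtained from
  the vector \<open>x(i) = \<alpha>\<close>, \<open>x(j) = - A\<^sup>-\<^sup>1 \<alpha>\<close>, \<open>x(*) = - b(\<alpha>, t)\<close> of a non-loop edge by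
  identifying \<open>j\<close> with \<open>i\<close>, whence the block \<open>(I - A\<^sup>-\<^sup>1) \<alpha>\<close>.

  Erratum: the source prints \<open>(I - A) \<alpha>\<close> here, and \<open>\<langle>p(i) - (A p(i) + t), x(i)\<rangle> = 0\<close> as the
  condition defining \<open>P'\<close> for a loop, where \<open>edge_P\<close> below imposes
  \<open>\<langle>p(i) - (A p(i) + t), \<alpha>\<rangle> = 0\<close>. Both printed forms change when the loop is reversed, and the
  theorem is false with either of them. Condition: for a single loop with a translation gain
  \<open>t \<noteq> 0\<close> on the line (\<open>d = k = 1\<close>) the printed condition is void, so that \<open>P' = U\<close> has dimension 1,
  while the truncation of \<open>h\<close> is 0. Block: take \<open>d = 2\<close> and four parallel edges with gains
  \<open>1, g, g\<^sup>2, g\<^sup>3\<close>, where \<open>g\<close> is a rotation of order 4 about a point \<open>c \<noteq> 0\<close>; the \<open>P'\<close> span a space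
  of dimension 3, while compressing with \<open>(I - A) \<alpha>\<close> along the edge with gain 1 makes the
  truncation equal to 4. Non-loop edges are unaffected.
\<close>

definition loop_vec ::
    "('k::finite \<Rightarrow> real^'n::finite^'n) \<Rightarrow> real^'n^'n \<Rightarrow> 'w::finite \<Rightarrow> 'n isometry \<Rightarrow> real^'n
     \<Rightarrow> (real^'n^'w) \<times> (real^'k)" where
  "loop_vec Bs B\<^sub>\<Gamma> i \<gamma> \<alpha> =
     ((\<chi> w. if w = i then (mat 1 - matrix_inv (fst \<gamma>)) *v \<alpha> else 0), - b_map Bs B\<^sub>\<Gamma> \<alpha> (snd \<gamma>))"

definition edge_U ::
    "('k::finite \<Rightarrow> real^'n::finite^'n) \<Rightarrow> real^'n^'n \<Rightarrow> 'w::finite \<Rightarrow> 'w \<Rightarrow> 'n isometry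
     \<Rightarrow> ((real^'n^'w) \<times> (real^'k)) set" where
  "edge_U Bs B\<^sub>\<Gamma> i j \<gamma> =
     (if i \<noteq> j
      then {x. fst x $ i + fst \<gamma> *v (fst x $ j) = 0 \<and>
               b_map Bs B\<^sub>\<Gamma> (fst x $ i) (snd \<gamma>) + snd x = 0 \<and> vanishes_off {i, j} x}
      else {x. \<exists>\<alpha>. x = loop_vec Bs B\<^sub>\<Gamma> i \<gamma> \<alpha>})"

definition edge_P ::
    "('k::finite \<Rightarrow> real^'n::finite^'n) \<Rightarrow> real^'n^'n \<Rightarrow> 'w::finite \<Rightarrow> 'w \<Rightarrow> 'n isometry
     \<Rightarrow> real^'n^'w \<Rightarrow> ((real^'n^'w) \<times> (real^'k)) set" where
  "edge_P Bs B\<^sub>\<Gamma> i j \<gamma> p =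
     (if i \<noteq> j
      then edge_U Bs B\<^sub>\<Gamma> i j \<gamma> \<inter> {x. (p $ i - (fst \<gamma> *v (p $ j) + snd \<gamma>)) \<bullet> (fst x $ i) = 0}
      else {x. \<exists>\<alpha>. x = loop_vec Bs B\<^sub>\<Gamma> i \<gamma> \<alpha> \<and>
                   (p $ i - (fst \<gamma> *v (p $ i) + snd \<gamma>)) \<bullet> \<alpha> = 0})"

section \<open>Gain graphs\<close>

text \<open>
  The edge \<open>e\<close> is directed from \<open>tail e\<close> to \<open>head e\<close>; a set \<open>F\<close> of edges stands for the
  subgraph \<open>(V(F), F)\<close>.
\<close>

definition ends :: "('e \<Rightarrow> 'v) \<Rightarrow> ('e \<Rightarrow> 'v) \<Rightarrow> 'e set \<Rightarrow> 'v set" where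
  "ends tail head F = tail ` F \<union> head ` F"

definition component_of ::
    "('e \<Rightarrow> 'v) \<Rightarrow> ('e \<Rightarrow> 'v) \<Rightarrow> 'e set \<Rightarrow> 'v \<Rightarrow> 'v set" where
  "component_of tail head F v =
     {w. (v, w) \<in> ({(tail e, head e) | e. e \<in> F} \<union> {(head e, tail e) | e. e \<in> F})\<^sup>*}"

definition edge_components :: "('e \<Rightarrow> 'v) \<Rightarrow> ('e \<Rightarrow> 'v) \<Rightarrow> 'e set \<Rightarrow> 'v set set" where
  "edge_components tail head F = component_of tail head F ` ends tail head F"

text \<open>Cycles are undirected; a loop has length 1 and a pair of parallel edges gives length 2.\<close>

definition cycle_in ::
    "('e \<Rightarrow> 'v) \<Rightarrow> ('e \<Rightarrow> 'v) \<Rightarrow> 'e set \<Rightarrow> 'v list \<Rightarrow> 'e list \<Rightarrow> bool" where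
  "cycle_in tail head F vs es \<longleftrightarrow>
     es \<noteq> [] \<and> length vs = length es \<and> distinct vs \<and> distinct es \<and> set es \<subseteq> F \<and>
     (\<forall>i < length es. {tail (es ! i), head (es ! i)} = {vs ! i, vs ! (Suc i mod length es)})"

definition edge_forest :: "('e \<Rightarrow> 'v) \<Rightarrow> ('e \<Rightarrow> 'v) \<Rightarrow> 'e set \<Rightarrow> bool" where
  "edge_forest tail head T \<longleftrightarrow> (\<nexists>vs es. cycle_in tail head T vs es)"

definition maximal_forest :: "('e \<Rightarrow> 'v) \<Rightarrow> ('e \<Rightarrow> 'v) \<Rightarrow> 'e set \<Rightarrow> 'e set \<Rightarrow> bool" where
  "maximal_forest tail head F T \<longleftrightarrow>
     T \<subseteq> F \<and> edge_forest tail head T \<and> (\<forall>e \<in> F - T. \<not> edge_forest tail head (insert e T))"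

definition switch ::
    "('e \<Rightarrow> 'v) \<Rightarrow> ('e \<Rightarrow> 'v) \<Rightarrow> 'v \<Rightarrow> 'n::finite isometry \<Rightarrow> ('e \<Rightarrow> 'n isometry)
     \<Rightarrow> ('e \<Rightarrow> 'n isometry)" where
  "switch tail head v \<gamma> \<psi> = (\<lambda>e.
     if tail e = v \<and> head e = v
       then \<gamma> \<otimes>\<^bsub>euclidean_group\<^esub> \<psi> e \<otimes>\<^bsub>euclidean_group\<^esub> inv\<^bsub>euclidean_group\<^esub> \<gamma>
     else if tail e = v then \<gamma> \<otimes>\<^bsub>euclidean_group\<^esub> \<psi> e
     else if head e = v then \<psi> e \<otimes>\<^bsub>euclidean_group\<^esub> inv\<^bsub>euclidean_group\<^esub> \<gamma>
     else \<psi> e)"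

inductive switchable ::
    "'n::finite isometry set \<Rightarrow> ('e \<Rightarrow> 'v) \<Rightarrow> ('e \<Rightarrow> 'v) \<Rightarrow> ('e \<Rightarrow> 'n isometry)
     \<Rightarrow> ('e \<Rightarrow> 'n isometry) \<Rightarrow> bool"
  for \<Gamma> tail head \<psi> where
  refl: "switchable \<Gamma> tail head \<psi> \<psi>"
| step: "switchable \<Gamma> tail head \<psi> \<phi> \<Longrightarrow> \<gamma> \<in> \<Gamma> \<Longrightarrow>
           switchable \<Gamma> tail head \<psi> (switch tail head v \<gamma> \<phi>)"

text \<open>\<open>\<phi>\<close> is a possible choice of \<open>\<psi>\<^sub>F\<^sup>\<circ>\<close>.\<close>

definition compressed_gain ::
    "'n::finite isometry set \<Rightarrow> ('e \<Rightarrow> 'v) \<Rightarrow> ('e \<Rightarrow> 'v) \<Rightarrow> ('e \<Rightarrow> 'n isometry) \<Rightarrow> 'e set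
     \<Rightarrow> ('e \<Rightarrow> 'n isometry) \<Rightarrow> bool" where
  "compressed_gain \<Gamma> tail head \<psi> F \<phi> \<longleftrightarrow>
     switchable \<Gamma> tail head \<psi> \<phi> \<and>
     (\<exists>T. maximal_forest tail head F T \<and> (\<forall>e\<in>T. \<phi> e = \<one>\<^bsub>euclidean_group\<^esub>))"

text \<open>
  A vertex of the compressed graph is a component of \<open>(V(F), F)\<close>, that is, a set of vertices.
  Its edges are loops, so the coordinates at the remaining sets of vertices are 0 in every
  subspace involved and do not affect the dimension.
\<close>

definition compressed_U ::
    "('k::finite \<Rightarrow> real^'n::finite^'n) \<Rightarrow> real^'n^'n \<Rightarrow> ('e \<Rightarrow> 'v::finite) \<Rightarrow> ('e \<Rightarrow> 'v)
     \<Rightarrow> ('e \<Rightarrow> 'n isometry) \<Rightarrow> 'e set \<Rightarrow> 'e \<Rightarrow> ((real^'n^('v set)) \<times> (real^'k)) set" where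
  "compressed_U Bs B\<^sub>\<Gamma> tail head \<phi> F e =
     edge_U Bs B\<^sub>\<Gamma> (component_of tail head F (tail e)) (component_of tail head F (head e)) (\<phi> e)"

text \<open>\<open>\<psi>\<^sub>0 F\<close> is the chosen \<open>\<psi>\<^sub>F\<^sup>\<circ>\<close>.\<close>

definition h_space_group ::
    "('k::finite \<Rightarrow> real^'n::finite^'n) \<Rightarrow> real^'n^'n \<Rightarrow> ('e \<Rightarrow> 'v::finite) \<Rightarrow> ('e \<Rightarrow> 'v)
     \<Rightarrow> ('e set \<Rightarrow> 'e \<Rightarrow> 'n isometry) \<Rightarrow> 'e set \<Rightarrow> int" where
  "h_space_group Bs B\<^sub>\<Gamma> tail head \<psi>\<^sub>0 F =
     int CARD('n) * int (card (ends tail head F))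
     - int CARD('n) * int (card (edge_components tail head F))
     + int (dim (span (\<Union>e\<in>F. compressed_U Bs B\<^sub>\<Gamma> tail head (\<psi>\<^sub>0 F) F e))) - 1"

definition dilworth_truncation :: "('e set \<Rightarrow> int) \<Rightarrow> 'e set \<Rightarrow> int" where
  "dilworth_truncation h F =
     (let Fp = {e \<in> F. 0 \<le> h {e}}
      in if Fp = {} then 0 else Min {(\<Sum>X\<in>P. h X) | P. partition_on Fp P})"

end

(*
  Let s be the coordinate vector of the lattice B and q = (p, s). Then every P'(p) is the section of U by
  the single hyperplane orthogonal to q, and h(F) + 1 is the dimension of the span of the U over F:
  switching is a linear isomorphism, and contracting a maximal forest is the quotient by the U of its
  edges. So the theorem is Lovasz's theorem on generic hyperplane sections of a family of subspaces.

  For the latter let q maximize the dimension of W, the span of the sections, and let u_e be the point of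
  U_e with q . u_e = 1, modulo W. Differentiating a relation between vectors x_e of the sections in
  the direction of q shows that it remains a relation after multiplying x_e by a(u_e), for every functional
  a vanishing on W. By interpolation W is the direct sum of the spans over the classes of equal u_e mod W,
  and these classes form an optimal partition.

  The component s is not free. But the invertible matrices commuting with the point group act transitively
  on the invertible lattices and preserve all the U, so the maximum over all q is attained over the given s,
  and then at almost every p.
*)

theory Submission
  imports Defs
begin

section \<open>Generic dimension of a linear family\<close>

text \<open>The section of a subspace by the hyperplane orthogonal to q is not linear in q. It is
  therefore spanned by the vectors (q . y) x - (q . x) y with x, y in the subspace, so that every
  genericity statement concerns the span at q of a family of linear maps. One bilinear perturbation
  yields all that is needed about such spans: the dimension is lower semicontinuous, it drops at
  only finitely many points of a line through q, and at a maximum the derivative of a relation stays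
  in the span. A direct sum over the classes does not by itself make the partition optimal. If V(C)
  is the span of the sections in a class C and U(C) the span of its U_e, one also needs dim V(C)
  \<ge> dim U(C) - 1, hence u_e - u_f in V(C), while the definition of a class only puts it in W.
  These are finitely many conditions, so almost every p meets all of them.\<close>

definition gen_span :: "('a \<Rightarrow> 'b::real_vector) set \<Rightarrow> 'a \<Rightarrow> 'b set" where
  "gen_span G q = span ((\<lambda>g. g q) ` G)"

text \<open>
  One bilinear \<open>T\<close> transports \<open>gen_span G q\<close> into \<open>gen_span G (q + r)\<close> for all \<open>r\<close> at once, so that
  lower bounds on dimensions reduce to injectivity of \<open>1 + T r\<close>.
\<close>

lemma gen_span_perturbation:
  fixes G :: "('a::euclidean_space \<Rightarrow> 'b::euclidean_space) set"
  assumes lin: "\<And>g. g \<in> G \<Longrightarrow> linear g"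
  shows "\<exists>T. bilinear T \<and> (\<forall>r. \<forall>x \<in> gen_span G q. x + T r x \<in> gen_span G (q + r)) \<and>
    (z \<notin> gen_span G q \<longrightarrow> (\<forall>r. T r z = 0))"
proof -
  obtain B where B: "B \<subseteq> (\<lambda>g. g q) ` G" "independent B" "(\<lambda>g. g q) ` G \<subseteq> span B"
    by (rule maximal_independent_subset)
  have spanB: "span B = gen_span G q"
    unfolding gen_span_def using span_mono[OF B(1)] span_minimal[OF B(3) subspace_span] by blast
  have "\<forall>b\<in>B. \<exists>g. g \<in> G \<and> g q = b" using B(1) by auto
  from bchoice[OF this] obtain \<gamma> where \<gamma>: "\<And>b. b \<in> B \<Longrightarrow> \<gamma> b \<in> G \<and> \<gamma> b q = b"
    by blast
  \<comment> \<open>\<open>z\<close> joins the basis whenever it is independent of \<open>B\<close>.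
    As \<open>T r\<close> is supported on \<open>B\<close>, this forces
    \<open>T r z = 0\<close>.\<close>
  define B2 where "B2 = (if z \<in> span B then B else insert z B)"
  have "independent B2"
    using B(2) by (auto simp: B2_def independent_insert span_base)
  then obtain B' where B': "B2 \<subseteq> B'" "independent B'" "UNIV \<subseteq> span B'"
    by (metis maximal_independent_subset_extend subset_UNIV)
  have fin: "finite B'" using B'(2) by (rule independent_imp_finite)
  have BB': "B \<subseteq> B'" using B'(1) by (auto simp: B2_def split: if_splits)
  \<comment> \<open>\<open>T r\<close> sends each \<open>b\<close> in \<open>B\<close> to
    \<open>\<gamma> b r\<close> and kills the other basis vectors, so that
    \<open>b + T r b = \<gamma> b (q + r)\<close>.\<close>
  define T where "T = (\<lambda>r x. \<Sum>b\<in>B. representation B' x b *\<^sub>R \<gamma> b r)"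
  have rep_add: "representation B' (x + y) b = representation B' x b + representation B' y b"
    and rep_scale: "representation B' (c *\<^sub>R x) b = c * representation B' x b" for x y b c
    using B'(3) by (auto simp: representation_add[OF B'(2)] representation_scale[OF B'(2)] subset_iff)
  have "bilinear T"
    unfolding bilinear_def
  proof (intro conjI allI)
    show "linear (T r)" for r
      by (rule linearI) (simp_all add: T_def rep_add rep_scale scaleR_add_left sum.distrib
          scaleR_right.sum)
    show "linear (\<lambda>r. T r x)" for x
      unfolding T_def
      by (intro linear_compose_sum ballI linear_compose_scale_right)
        (use lin \<gamma> in blast)
  qed
  have Tb: "T r b = \<gamma> b r" if "b \<in> B" for r b
  proof -
    have "T r b = (\<Sum>c\<in>B. (if c = b then \<gamma> b r else 0))"
      unfolding T_def using that BB' by (intro sum.cong) (auto simp: representation_basis[OF B'(2)])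
    then show ?thesis using that fin BB' by (simp add: sum.delta finite_subset)
  qed
  have "x + T r x \<in> gen_span G (q + r)" if "x \<in> gen_span G q" for r x
  proof -
    have "x \<in> span B" using that spanB by simp
    then show ?thesis
    proof (induction rule: span_induct_alt)
      case base
      show ?case using \<open>bilinear T\<close> by (simp add: bilinear_rzero gen_span_def span_zero)
    next
      case (step c b y)
      have "b + T r b = \<gamma> b (q + r)"
        using step(1) Tb[of b r] \<gamma>[of b] lin[of "\<gamma> b"] by (simp add: linear_add)
      also have "\<dots> \<in> gen_span G (q + r)"
        unfolding gen_span_def using \<gamma> step by (auto intro!: span_base)
      finally have "c *\<^sub>R (b + T r b) + (y + T r y) \<in> gen_span G (q + r)"
        using step(2) unfolding gen_span_def by (rule span_add[OF span_scale])
      then show ?case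
        using \<open>bilinear T\<close> by (simp add: bilinear_radd bilinear_rmul algebra_simps)
    qed
  qed
  moreover have "T r z = 0" if "z \<notin> gen_span G q" for r
  proof -
    have "z \<notin> span B" using that spanB by simp
    then have "z \<in> B'" "z \<notin> B" using B'(1) by (auto simp: B2_def span_base)
    then show ?thesis
      unfolding T_def by (intro sum.neutral ballI) (auto simp: representation_basis[OF B'(2)])
  qed
  ultimately show ?thesis using \<open>bilinear T\<close> by blast
qed

section \<open>Injective pencils and semicontinuity of the rank\<close>

lemma dim_le_inj_linear:
  fixes S :: "'b::euclidean_space set" and f :: "'b \<Rightarrow> 'b"
  assumes "linear f" "inj f" "\<And>x. x \<in> S \<Longrightarrow> f x \<in> R"
  shows "dim S \<le> dim R"
  using assms by (metis dim_image_eq dim_subset image_subsetI inj_on_subset subset_UNIV)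

text \<open>Applying \<open>T - m\<close> to a relation removes the eigenvector for \<open>m\<close>
  and multiplies every other coefficient by \<open>l - m \<noteq> 0\<close>, which leaves a relation
  over a smaller set.\<close>

lemma eigenvectors_independent:
  fixes T :: "'b::real_vector \<Rightarrow> 'b"
  assumes "linear T" "finite S" "\<And>l. l \<in> S \<Longrightarrow> x l \<noteq> 0 \<and> T (x l) = l *\<^sub>R x l"
    and "(\<Sum>l\<in>S. c l *\<^sub>R x l) = 0" "l \<in> S"
  shows "c l = 0"
  using assms(2-)
proof (induction S arbitrary: c l rule: finite_induct)
  case (insert m S)
  have "T (\<Sum>l\<in>insert m S. c l *\<^sub>R x l) - m *\<^sub>R (\<Sum>l\<in>insert m S. c l *\<^sub>R x l) = 0"
    using insert.prems(2) linear_0[OF \<open>linear T\<close>] by simp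
  moreover have "T (\<Sum>l\<in>insert m S. c l *\<^sub>R x l) - m *\<^sub>R (\<Sum>l\<in>insert m S. c l *\<^sub>R x l)
      = (\<Sum>l\<in>insert m S. (c l * (l - m)) *\<^sub>R x l)"
    unfolding linear_sum[OF \<open>linear T\<close>] linear_scale[OF \<open>linear T\<close>] scaleR_right.sum sum_subtractf[symmetric]
  proof (rule sum.cong[OF HOL.refl])
    fix l assume "l \<in> insert m S"
    then have "T (x l) = l *\<^sub>R x l" using insert.prems(1) by blast
    then show "c l *\<^sub>R T (x l) - m *\<^sub>R c l *\<^sub>R x l = (c l * (l - m)) *\<^sub>R x l"
      by (simp add: algebra_simps)
  qed
  ultimately have "(\<Sum>l\<in>S. (c l * (l - m)) *\<^sub>R x l) = 0"
    using insert.hyps by simp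
  then have "c l * (l - m) = 0" if "l \<in> S" for l
    using insert.IH[of "\<lambda>l. c l * (l - m)"] insert.prems(1) that by blast
  then have z: "c l = 0" if "l \<in> S" for l
    using that insert.hyps(2) by auto
  then have "c m *\<^sub>R x m = 0"
    using insert.prems(2) insert.hyps by simp
  then show ?case using z insert.prems by auto
qed simp

text \<open>A nonzero kernel vector of \<open>1 + \<tau> T\<close> is an eigenvector of
  \<open>T\<close> for \<open>- 1 / \<tau>\<close>, where \<tau> \<noteq> 0 because the identity is
  injective. Distinct \<tau> give distinct eigenvalues, and there are at most \<open>DIM('b)\<close>
  of them.\<close>

lemma finite_noninjective_pencil:
  fixes T :: "'b::euclidean_space \<Rightarrow> 'b"
  assumes "linear T"
  shows "finite {\<tau>. \<not> inj (\<lambda>x. x + \<tau> *\<^sub>R T x)}" (is "finite ?N")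
proof (rule ccontr)
  assume inf: "infinite ?N"
  have lin: "linear (\<lambda>x. x + \<tau> *\<^sub>R T x)" for \<tau>
    by (rule linearI) (simp_all add: linear_add[OF assms] linear_scale[OF assms] algebra_simps)
  have "\<exists>x. x \<noteq> 0 \<and> x + \<tau> *\<^sub>R T x = 0" if "\<tau> \<in> ?N" for \<tau>
    using that by (auto simp: linear_injective_0[OF lin])
  then have "\<forall>\<tau>\<in>?N. \<exists>x. x \<noteq> 0 \<and> x + \<tau> *\<^sub>R T x = 0" by blast
  from bchoice[OF this] obtain x where x: "\<And>\<tau>. \<tau> \<in> ?N \<Longrightarrow> x \<tau> \<noteq> 0 \<and> x \<tau> + \<tau> *\<^sub>R T (x \<tau>) = 0"
    by blast
  have nz: "\<tau> \<noteq> 0" if "\<tau> \<in> ?N" for \<tau> using x[OF that] by auto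
  obtain S where S: "S \<subseteq> ?N" "finite S" "card S = Suc DIM('b)"
    using infinite_arbitrarily_large[OF inf] by blast
  define L where "L = (\<lambda>\<tau>. - inverse \<tau>) ` S"
  have fL: "finite L" and injL: "inj_on (\<lambda>\<tau>. - inverse \<tau>) S"
    using S by (auto simp: L_def inj_on_def)
  define y where "y = (\<lambda>l. x (- inverse l))"
  have y: "y l \<noteq> 0 \<and> T (y l) = l *\<^sub>R y l" if "l \<in> L" for l
  proof -
    from that obtain \<tau> where \<tau>: "\<tau> \<in> S" "l = - inverse \<tau>" unfolding L_def by blast
    then have "x \<tau> + \<tau> *\<^sub>R T (x \<tau>) = 0" "\<tau> \<noteq> 0" "x \<tau> \<noteq> 0" using x nz S(1) by auto
    then have "inverse \<tau> *\<^sub>R (\<tau> *\<^sub>R T (x \<tau>)) = inverse \<tau> *\<^sub>R (- x \<tau>)"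
      by (simp add: add_eq_0_iff)
    then have "T (x \<tau>) = - inverse \<tau> *\<^sub>R x \<tau>"
      using \<open>\<tau> \<noteq> 0\<close> by simp
    then show ?thesis using \<tau> \<open>x \<tau> \<noteq> 0\<close> by (simp add: y_def)
  qed
  have ind: "c l = 0" if "(\<Sum>l\<in>L. c l *\<^sub>R y l) = 0" "l \<in> L" for c l
    using eigenvectors_independent[OF assms fL y that] by blast
  have inj: "inj_on y L"
  proof (rule inj_onI, rule ccontr)
    fix l m assume lm: "l \<in> L" "m \<in> L" "y l = y m" "l \<noteq> m"
    then have "(l - m) *\<^sub>R y l = 0" using y[OF lm(1)] y[OF lm(2)] by (simp add: scaleR_left_diff_distrib)
    then show False using y lm by auto
  qed
  have "independent (y ` L)"
    unfolding independent_explicit_finite_subsets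
  proof (intro allI impI ballI)
    fix A u v assume A: "A \<subseteq> y ` L" "finite A" "(\<Sum>v\<in>A. u v *\<^sub>R v) = 0" "v \<in> A"
    have "(\<Sum>l\<in>L. (if y l \<in> A then u (y l) else 0) *\<^sub>R y l) = (\<Sum>v\<in>y ` L. (if v \<in> A then u v else 0) *\<^sub>R v)"
      by (simp add: sum.reindex[OF inj])
    also have "\<dots> = (\<Sum>v\<in>A. u v *\<^sub>R v)"
      using A(1) fL by (intro sum.mono_neutral_cong_right) auto
    also have "\<dots> = 0" by (rule A(3))
    finally have "(if y l \<in> A then u (y l) else 0) = 0" if "l \<in> L" for l
      using that by (rule ind)
    moreover obtain l where "l \<in> L" "v = y l" using A(1,4) by auto
    ultimately show "u v = 0" using A(4) by force
  qed
  then have "card (y ` L) \<le> DIM('b)"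
    by (rule independent_bound[THEN conjunct2])
  moreover have "card (y ` L) = card S"
    using card_image[OF inj] card_image[OF injL] by (simp add: L_def)
  ultimately show False using S(3) by simp
qed

lemma linear_pencil:
  assumes "bilinear T"
  shows "linear (\<lambda>x. x + T r x)"
  by (rule linearI) (simp_all add: bilinear_radd[OF assms] bilinear_rmul[OF assms] algebra_simps)

text \<open>Bilinearity bounds \<open>T r x\<close> by K |r| |x|, so for |r| < 1/K it is shorter
  than a nonzero \<open>x\<close> and cannot cancel it.\<close>

lemma inj_add_small:
  fixes T :: "'a::euclidean_space \<Rightarrow> 'b::euclidean_space \<Rightarrow> 'b"
  assumes "bilinear T"
  obtains \<epsilon> where "\<epsilon> > 0" "\<And>r. norm r < \<epsilon> \<Longrightarrow> inj (\<lambda>x. x + T r x)"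
proof -
  obtain K where K: "K > 0" "\<And>r x. norm (T r x) \<le> K * norm r * norm x"
    using bilinear_bounded_pos[OF assms] by (metis mult.assoc)
  have "inj (\<lambda>x. x + T r x)" if "norm r < 1 / K" for r
  proof -
    have lin: "linear (\<lambda>x. x + T r x)"
      by (rule linear_pencil[OF assms])
    have "x = 0" if "x + T r x = 0" for x
    proof (rule ccontr)
      assume "x \<noteq> 0"
      have "norm x = norm (T r x)" using that by (metis add_eq_0_iff norm_minus_cancel)
      also have "\<dots> \<le> K * norm r * norm x" by (rule K)
      also have "\<dots> < 1 * norm x"
        using \<open>norm r < 1 / K\<close> K(1) \<open>x \<noteq> 0\<close> by (intro mult_strict_right_mono) (auto simp: field_simps)
      finally show False by simp
    qed
    then show ?thesis unfolding linear_injective_0[OF lin] by blast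
  qed
  then show ?thesis using that[of "1 / K"] K(1) by auto
qed

lemma open_dim_gen_span:
  fixes G :: "('a::euclidean_space \<Rightarrow> 'b::euclidean_space) set"
  assumes "\<And>g. g \<in> G \<Longrightarrow> linear g"
  shows "open {q. m \<le> dim (gen_span G q)}"
unfolding open_contains_ball
proof
  fix q assume q: "q \<in> {q. m \<le> dim (gen_span G q)}"
  obtain T where T: "bilinear T" "\<And>r x. x \<in> gen_span G q \<Longrightarrow> x + T r x \<in> gen_span G (q + r)"
    using gen_span_perturbation[of G q 0] assms by blast
  obtain \<epsilon> where \<epsilon>: "\<epsilon> > 0" "\<And>r. norm r < \<epsilon> \<Longrightarrow> inj (\<lambda>x. x + T r x)"
    using inj_add_small[OF T(1)] by blast
  have "m \<le> dim (gen_span G q')" if "dist q q' < \<epsilon>" for q'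
  proof -
    have "dim (gen_span G q) \<le> dim (gen_span G (q + (q' - q)))"
      using that by (intro dim_le_inj_linear[OF linear_pencil[OF T(1), of "q' - q"]] \<epsilon>(2) T(2))
        (simp_all add: dist_norm norm_minus_commute)
    then show ?thesis using q by simp
  qed
  then show "\<exists>\<epsilon>>0. ball q \<epsilon> \<subseteq> {q. m \<le> dim (gen_span G q)}"
    using \<epsilon>(1) by (intro exI[of _ \<epsilon>]) auto
qed

text \<open>Takes the place of a nonvanishing minor: a drop at \<tau> forces the pencil
  \<open>1 + \<tau> T r\<close> to be singular, which happens for finitely many \<tau>.\<close>

lemma finite_dim_gen_span_drop:
  fixes G :: "('a::euclidean_space \<Rightarrow> 'b::euclidean_space) set"
  assumes "\<And>g. g \<in> G \<Longrightarrow> linear g"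
  shows "finite {\<tau>. dim (gen_span G (q + \<tau> *\<^sub>R r)) < dim (gen_span G q)}"
proof -
  obtain T where T: "bilinear T" "\<And>r x. x \<in> gen_span G q \<Longrightarrow> x + T r x \<in> gen_span G (q + r)"
    using gen_span_perturbation[of G q 0] assms by blast
  have "inj (\<lambda>x. x + \<tau> *\<^sub>R T r x) \<Longrightarrow> dim (gen_span G q) \<le> dim (gen_span G (q + \<tau> *\<^sub>R r))" for \<tau>
    by (rule dim_le_inj_linear[OF linear_pencil[OF T(1), of "\<tau> *\<^sub>R r"] _ T(2)])
      (simp_all add: bilinear_lmul[OF T(1)])
  then have "{\<tau>. dim (gen_span G (q + \<tau> *\<^sub>R r)) < dim (gen_span G q)} \<subseteq> {\<tau>. \<not> inj (\<lambda>x. x + \<tau> *\<^sub>R T r x)}"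
    by (auto simp: not_less[symmetric])
  moreover have "linear (T r)" using T(1) by (simp add: bilinear_def)
  ultimately show ?thesis
    by (rule finite_subset[OF _ finite_noninjective_pencil])
qed

text \<open>
  Otherwise the derivative of the vanishing combination would enlarge the span at \<open>q + \<tau> r\<close> for small \<open>\<tau>\<close>.
\<close>

lemma gen_span_derivative:
  fixes G :: "('a::euclidean_space \<Rightarrow> 'b::euclidean_space) set"
  assumes lin: "\<And>g. g \<in> G \<Longrightarrow> linear g"
    and max: "\<And>q'. dim (gen_span G q') \<le> dim (gen_span G q)"
    and I: "\<And>i. i \<in> I \<Longrightarrow> g i \<in> G" "(\<Sum>i\<in>I. c i *\<^sub>R g i q) = 0"
  shows "(\<Sum>i\<in>I. c i *\<^sub>R g i r) \<in> gen_span G q" (is "?z \<in> _")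
proof (rule ccontr)
  assume z: "?z \<notin> gen_span G q"
  obtain T where T: "bilinear T" "\<And>r x. x \<in> gen_span G q \<Longrightarrow> x + T r x \<in> gen_span G (q + r)"
    and T0: "\<And>r. T r ?z = 0"
    using gen_span_perturbation[of G q ?z] lin z by blast
  obtain \<epsilon> where \<epsilon>: "\<epsilon> > 0" "\<And>r. norm r < \<epsilon> \<Longrightarrow> inj (\<lambda>x. x + T r x)"
    using inj_add_small[OF T(1)] by blast
  have "((\<lambda>\<tau>. norm (\<tau> *\<^sub>R r)) \<longlongrightarrow> norm (0 *\<^sub>R r)) (at_right 0)"
    by (intro tendsto_intros)
  then have "\<forall>\<^sub>F \<tau> in at_right 0. 0 < \<tau> \<and> norm (\<tau> *\<^sub>R r) < \<epsilon>"
    using \<epsilon>(1) by (intro eventually_conj eventually_at_right_less order_tendstoD(2)) auto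
  then obtain \<tau> :: real where \<tau>: "\<tau> > 0" "norm (\<tau> *\<^sub>R r) < \<epsilon>"
    using eventually_happens by force
  have "(\<Sum>i\<in>I. c i *\<^sub>R g i (q + \<tau> *\<^sub>R r)) = (\<Sum>i\<in>I. c i *\<^sub>R g i q + \<tau> *\<^sub>R (c i *\<^sub>R g i r))"
  proof (rule sum.cong[OF HOL.refl])
    fix i assume "i \<in> I"
    then have "linear (g i)" using lin I(1) by blast
    then show "c i *\<^sub>R g i (q + \<tau> *\<^sub>R r) = c i *\<^sub>R g i q + \<tau> *\<^sub>R (c i *\<^sub>R g i r)"
      by (simp add: linear_add linear_scale scaleR_add_right mult.commute)
  qed
  also have "\<dots> = (\<Sum>i\<in>I. c i *\<^sub>R g i q) + \<tau> *\<^sub>R ?z"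
    by (simp only: sum.distrib scaleR_right.sum)
  finally have "\<tau> *\<^sub>R ?z = (\<Sum>i\<in>I. c i *\<^sub>R g i (q + \<tau> *\<^sub>R r))"
    by (simp add: I(2))
  then have "inverse \<tau> *\<^sub>R (\<tau> *\<^sub>R ?z) \<in> gen_span G (q + \<tau> *\<^sub>R r)"
    unfolding gen_span_def using I(1)
    by (simp only:) (intro span_scale span_sum span_base imageI)
  then have zR: "?z \<in> gen_span G (q + \<tau> *\<^sub>R r)"
    using \<tau>(1) by simp
  \<comment> \<open>\<open>T\<close> kills \<open>?z\<close>, so the injective map fixes it and
    carries a set of dimension one larger into the span at \<open>q + \<tau> r\<close>.\<close>
  have "x + T (\<tau> *\<^sub>R r) x \<in> gen_span G (q + \<tau> *\<^sub>R r)" if "x \<in> insert ?z (gen_span G q)" for x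
    using that T(2) T0 zR by auto
  from dim_le_inj_linear[OF linear_pencil[OF T(1)] \<epsilon>(2)[OF \<tau>(2)] this]
  have "dim (insert ?z (gen_span G q)) \<le> dim (gen_span G (q + \<tau> *\<^sub>R r))" .
  moreover have "dim (insert ?z (gen_span G q)) = dim (gen_span G q) + 1"
    using z by (simp add: dim_insert gen_span_def span_span)
  ultimately show False using max[of "q + \<tau> *\<^sub>R r"] by simp
qed

section \<open>From finiteness on rays to almost every point\<close>

lemma ae_lborel_ne_bot: "ae_filter (lborel :: 'a::euclidean_space measure) \<noteq> bot"
  using emeasure_lborel_UNIV by (simp add: ae_filter_eq_bot_iff)

text \<open>By Fubini, some dilate of the complement of \<open>U\<close> about \<open>a\<close> is a null set.\<close>

lemma AE_lborel_radial:
  fixes U :: "'a::euclidean_space set"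
  assumes "open U" and fin: "\<And>x. finite {\<tau>. a + \<tau> *\<^sub>R x \<notin> U}"
  shows "AE x in lborel. x \<in> U"
proof -
  have "pair_sigma_finite (lborel :: real measure) (lborel :: 'a measure)" ..
  note comm = pair_sigma_finite.AE_commute[OF this, of "\<lambda>\<tau> x. a + \<tau> *\<^sub>R x \<in> U"]
  have "open ((\<lambda>z :: real \<times> 'a. a + fst z *\<^sub>R snd z) -` U)"
    by (intro open_vimage assms(1) continuous_intros)
  then have "{z \<in> space (lborel \<Otimes>\<^sub>M lborel). a + fst z *\<^sub>R snd z \<in> U} \<in> sets (lborel \<Otimes>\<^sub>M (lborel :: 'a measure))"
    unfolding lborel_prod by (simp add: vimage_def)
  note comm = comm[OF this]
  have "AE \<tau> in lborel. a + \<tau> *\<^sub>R x \<in> U" for x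
    using finite_imp_null_set_lborel[OF fin] by (rule AE_I') auto
  then have "AE \<tau> in lborel. AE x in (lborel :: 'a measure). a + \<tau> *\<^sub>R x \<in> U"
    using comm by simp
  \<comment> \<open>Only for \<tau> \<noteq> 0 is x -> a + \<tau> x a similarity, under which
    Lebesgue measure is merely rescaled.\<close>
  moreover have "AE \<tau> in lborel. \<tau> \<noteq> (0::real)"
    by (rule AE_lborel_singleton)
  ultimately have "AE \<tau> in lborel. \<tau> \<noteq> 0 \<and> (AE x in (lborel :: 'a measure). a + \<tau> *\<^sub>R x \<in> U)"
    by eventually_elim simp
  then obtain \<tau> where \<tau>: "\<tau> \<noteq> 0" "AE x in (lborel :: 'a measure). a + \<tau> *\<^sub>R x \<in> U"
    using eventually_happens'[OF ae_lborel_ne_bot] by blast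
  have "{x. x \<in> U} \<in> sets borel" using assms(1) by simp
  then have "AE x in distr lborel borel (\<lambda>x. a + \<tau> *\<^sub>R x). x \<in> U"
    using \<tau>(2) by (subst AE_distr_iff) auto
  then have "AE x in density (distr lborel borel (\<lambda>x. a + \<tau> *\<^sub>R x)) (\<lambda>_. ennreal (\<bar>\<tau>\<bar> ^ DIM('a))). x \<in> U"
    by (subst AE_density) auto
  then show ?thesis
    by (subst lborel_affine[OF \<tau>(1), of a])
qed

section \<open>Generic hyperplane sections of a family of subspaces\<close>

lemma span_UN_eq_sums:
  fixes H :: "'e \<Rightarrow> 'b::real_vector set"
  assumes "finite E" "\<And>e. e \<in> E \<Longrightarrow> subspace (H e)"
  shows "span (\<Union>e\<in>E. H e) = {\<Sum>e\<in>E. x e | x. \<forall>e\<in>E. x e \<in> H e}"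
proof (intro equalityI subsetI)
  fix z assume z: "z \<in> span (\<Union>e\<in>E. H e)"
  have "\<exists>x. (\<forall>e\<in>E. x e \<in> H e) \<and> z = (\<Sum>e\<in>E. x e)"
    using assms z
  proof (induction E arbitrary: z rule: finite_induct)
    case (insert e E)
    then have "z \<in> span (H e \<union> (\<Union>e\<in>E. H e))" by simp
    then obtain a b where ab: "z = a + b" "a \<in> span (H e)" "b \<in> span (\<Union>e\<in>E. H e)"
      unfolding span_Un by blast
    obtain x where x: "\<forall>e\<in>E. x e \<in> H e" "b = (\<Sum>e\<in>E. x e)"
      using insert.IH[OF _ ab(3)] insert.prems(1) by auto
    have "a \<in> H e" using ab(2) insert.prems(1) by (simp add: span_eq_iff[THEN iffD2])
    then show ?case
      using x ab(1) insert.hyps by (intro exI[of _ "x(e := a)"]) (auto intro!: sum.cong)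
  qed simp
  then show "z \<in> {\<Sum>e\<in>E. x e | x. \<forall>e\<in>E. x e \<in> H e}" by blast
qed (auto intro!: span_sum intro: span_base)

lemma dim_Un_le:
  fixes S T :: "'b::euclidean_space set"
  shows "dim (S \<union> T) \<le> dim S + dim T"
proof -
  have "dim (S \<union> T) = dim {x + y |x y. x \<in> span S \<and> y \<in> span T}"
    unfolding span_Un[symmetric] by simp
  also have "\<dots> \<le> dim (span S) + dim (span T)"
    using dim_sums_Int[of "span S" "span T"] by simp
  finally show ?thesis by simp
qed

lemma dim_UN_le:
  fixes H :: "'e \<Rightarrow> 'b::euclidean_space set"
  assumes "finite E"
  shows "dim (\<Union>e\<in>E. H e) \<le> (\<Sum>e\<in>E. dim (H e))"
  using assms
proof (induction E rule: finite_induct)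
  case (insert e E)
  then show ?case
    using dim_Un_le[of "H e" "\<Union>e\<in>E. H e"] by simp
qed simp

lemma dim_UN_direct:
  fixes H :: "'e \<Rightarrow> 'b::euclidean_space set"
  assumes "finite E" "\<And>e. e \<in> E \<Longrightarrow> subspace (H e)"
    and "\<And>x e. (\<And>e. e \<in> E \<Longrightarrow> x e \<in> H e) \<Longrightarrow> (\<Sum>e\<in>E. x e) = 0 \<Longrightarrow> e \<in> E \<Longrightarrow> x e = 0"
  shows "dim (\<Union>e\<in>E. H e) = (\<Sum>e\<in>E. dim (H e))"
  using assms
proof (induction E rule: finite_induct)
  case (insert e E)
  have IH: "dim (\<Union>e\<in>E. H e) = (\<Sum>e\<in>E. dim (H e))"
  proof (rule insert.IH)
    fix x f assume x: "\<And>e. e \<in> E \<Longrightarrow> x e \<in> H e" "(\<Sum>e\<in>E. x e) = 0" "f \<in> E"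
    have "(x(e := 0)) f = 0"
    proof (rule insert.prems(2))
      show "(x(e := 0)) d \<in> H d" if "d \<in> insert e E" for d
        using that x insert.prems(1) by (auto simp: subspace_0)
      have "(\<Sum>d\<in>E. (x(e := 0)) d) = (\<Sum>d\<in>E. x d)"
        using insert.hyps by (intro sum.cong) auto
      then show "(\<Sum>d\<in>insert e E. (x(e := 0)) d) = 0"
        using x(2) insert.hyps by simp
    qed (use x in auto)
    then show "x f = 0" using x(3) insert.hyps by (auto split: if_splits)
  qed (use insert.prems in auto)
  let ?S = "span (\<Union>e\<in>E. H e)"
  have "z = 0" if "z \<in> H e" "z \<in> ?S" for z
  proof -
    have "?S = {\<Sum>e\<in>E. x e | x. \<forall>e\<in>E. x e \<in> H e}"
      using insert.prems(1) by (intro span_UN_eq_sums insert.hyps(1)) auto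
    then obtain x where x: "\<forall>e\<in>E. x e \<in> H e" "z = (\<Sum>e\<in>E. x e)"
      using \<open>z \<in> ?S\<close> by blast
    have "(x(e := - z)) e = 0"
    proof (rule insert.prems(2)[of "x(e := - z)"])
      show "(x(e := - z)) d \<in> H d" if "d \<in> insert e E" for d
        using \<open>d \<in> insert e E\<close> x(1) \<open>z \<in> H e\<close> insert.prems(1) by (auto simp: subspace_neg)
      have "(\<Sum>d\<in>E. (x(e := - z)) d) = (\<Sum>d\<in>E. x d)"
        using insert.hyps by (intro sum.cong) auto
      then show "(\<Sum>d\<in>insert e E. (x(e := - z)) d) = 0"
        using x(2) insert.hyps by simp
    qed simp
    then show ?thesis by simp
  qed
  then have int: "H e \<inter> ?S = {0}"
    using insert.prems(1) by (auto simp: subspace_0 span_zero)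
  have "dim (\<Union>e\<in>insert e E. H e) = dim (span (H e \<union> (\<Union>e\<in>E. H e)))" by simp
  also have "\<dots> = dim {x + y |x y. x \<in> H e \<and> y \<in> ?S}"
    unfolding span_Un using insert.prems(1) by (simp add: span_eq_iff[THEN iffD2])
  also have "\<dots> = dim (H e) + dim ?S"
    using dim_sums_Int[of "H e" ?S] insert.prems(1) int by simp
  finally show ?case using IH insert.hyps by simp
qed simp

text \<open>
  If \<open>q\<close> is not orthogonal to a subspace \<open>S\<close>, the vectors \<open>cross_map x y q\<close> with \<open>x, y \<in> S\<close> span
  \<open>S \<inter> q\<^sup>\<bottom>\<close>; they depend linearly on \<open>q\<close>.
\<close>

definition cross_map :: "'b \<Rightarrow> 'b \<Rightarrow> 'b \<Rightarrow> 'b::real_inner" where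
  "cross_map x y q = (q \<bullet> y) *\<^sub>R x - (q \<bullet> x) *\<^sub>R y"

lemma linear_cross_map: "linear (cross_map x y)"
  unfolding cross_map_def by (rule linearI) (simp_all add: inner_simps algebra_simps)

definition cross_maps :: "('b \<times> 'b) set \<Rightarrow> ('b \<Rightarrow> 'b::real_inner) set" where
  "cross_maps D = (\<lambda>(x, y). cross_map x y) ` D"

lemma linear_cross_maps: "g \<in> cross_maps D \<Longrightarrow> linear g"
  by (auto simp: cross_maps_def linear_cross_map)

lemma gen_span_cross_maps: "gen_span (cross_maps D) q = span ((\<lambda>(x, y). cross_map x y q) ` D)"
  by (simp add: gen_span_def cross_maps_def image_image split_def)

definition pairs_within :: "('e \<Rightarrow> 'b set) \<Rightarrow> 'e set \<Rightarrow> ('b \<times> 'b) set" where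
  "pairs_within U E = (\<Union>e\<in>E. U e \<times> U e)"

text \<open>\<open>u e\<close> is a point of \<open>U e\<close> on the affine hyperplane q . x = 1.
  Condition \<open>max_dim_pair\<close> admits the mixed pairs of one
  \<open>U e \<times> U f\<close>, so that u e - u f can be differentiated like a vector of a
  section.\<close>

locale generic_section =
  fixes E :: "'e set" and U :: "'e \<Rightarrow> 'b::euclidean_space set" and q :: 'b and u :: "'e \<Rightarrow> 'b"
  assumes finite_E: "finite E"
    and subspace_U: "\<And>e. e \<in> E \<Longrightarrow> subspace (U e)"
    and u_in: "\<And>e. e \<in> E \<Longrightarrow> u e \<in> U e"
    and q_u: "\<And>e. e \<in> E \<Longrightarrow> q \<bullet> u e = 1"
    and max_dim: "\<And>q'. dim (gen_span (cross_maps (pairs_within U E)) q')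
        \<le> dim (gen_span (cross_maps (pairs_within U E)) q)"
    and max_dim_pair: "\<And>q' e f. e \<in> E \<Longrightarrow> f \<in> E \<Longrightarrow>
        dim (gen_span (cross_maps (pairs_within U E \<union> U e \<times> U f)) q')
        \<le> dim (gen_span (cross_maps (pairs_within U E \<union> U e \<times> U f)) q)"
begin

definition H :: "'e \<Rightarrow> 'b set" where "H e = U e \<inter> {x. q \<bullet> x = 0}"
definition W :: "'b set" where "W = span (\<Union>e\<in>E. H e)"
text \<open>Two choices of \<open>u e\<close> differ by a vector of \<open>H e\<close>, hence of
  \<open>W\<close>, so the classes depend only on \<open>q\<close>.\<close>

definition cls :: "'e \<Rightarrow> 'e set" where "cls f = {e \<in> E. u e - u f \<in> W}"

lemma subspace_W: "subspace W"
  by (simp add: W_def)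

lemma subspace_H: "e \<in> E \<Longrightarrow> subspace (H e)"
  unfolding H_def by (intro subspace_inter subspace_U subspace_hyperplane)

lemma H_sub_W: "e \<in> E \<Longrightarrow> x \<in> H e \<Longrightarrow> x \<in> W"
  unfolding W_def by (auto intro: span_base)

lemma W_sums: "W = {\<Sum>e\<in>E. x e | x. \<forall>e\<in>E. x e \<in> H e}"
  unfolding W_def by (rule span_UN_eq_sums[OF finite_E subspace_H])

lemma cross_map_u: "e \<in> E \<Longrightarrow> x \<in> H e \<Longrightarrow> cross_map x (u e) q = x"
  by (simp add: cross_map_def H_def q_u)

lemma cross_map_in_W: "e \<in> E \<Longrightarrow> x \<in> U e \<Longrightarrow> y \<in> U e \<Longrightarrow> cross_map x y q \<in> W"
  by (rule H_sub_W[of e]) (auto simp: H_def cross_map_def inner_simps subspace_U intro!: subspace_diff subspace_mul)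

lemma gen_span_within: "gen_span (cross_maps (pairs_within U E)) q = W"
proof (rule equalityI)
  show "gen_span (cross_maps (pairs_within U E)) q \<subseteq> W"
    unfolding gen_span_cross_maps
    by (rule span_minimal) (auto simp: pairs_within_def cross_map_in_W subspace_W)
  have "x \<in> (\<lambda>(x, y). cross_map x y q) ` pairs_within U E" if "e \<in> E" "x \<in> H e" for e x
    using that cross_map_u[OF that] u_in
    by (intro image_eqI[of _ _ "(x, u e)"]) (auto simp: pairs_within_def H_def)
  then show "W \<subseteq> gen_span (cross_maps (pairs_within U E)) q"
    unfolding gen_span_cross_maps W_def by (intro span_mono) blast
qed

lemma U_decomp:
  assumes "e \<in> E" "x \<in> U e"
  shows "x - (q \<bullet> x) *\<^sub>R u e \<in> H e"
  using assms subspace_U u_in by (auto simp: H_def inner_simps q_u intro!: subspace_diff subspace_mul)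

text \<open>Modulo \<open>W\<close> both \<open>U e\<close> and \<open>U f\<close> reduce to the
  line of one common vector, and a cross map of two multiples of one vector vanishes. The mixed
  pairs thus leave the span at \<open>q\<close> unchanged, and functionals vanishing on
  \<open>W\<close> can still test the derivatives.\<close>

lemma gen_span_pair:
  assumes ef: "e \<in> E" "f \<in> E" and "u e - u f \<in> W"
  shows "gen_span (cross_maps (pairs_within U E \<union> U e \<times> U f)) q = W"
proof (rule equalityI)
  show "W \<subseteq> gen_span (cross_maps (pairs_within U E \<union> U e \<times> U f)) q"
    unfolding gen_span_within[symmetric] gen_span_cross_maps by (intro span_mono) auto
  have sub: "subspace W" by (simp add: W_def)
  have "cross_map x y q \<in> W" if "x \<in> U e" "y \<in> U f" for x y
  proof -
    have "cross_map x y q = (q \<bullet> y) *\<^sub>R (x - (q \<bullet> x) *\<^sub>R u e) - (q \<bullet> x) *\<^sub>R (y - (q \<bullet> y) *\<^sub>R u f)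
      + ((q \<bullet> x) * (q \<bullet> y)) *\<^sub>R (u e - u f)"
      by (simp add: cross_map_def algebra_simps)
    then show ?thesis
      using U_decomp[OF ef(1) that(1)] U_decomp[OF ef(2) that(2)] H_sub_W ef assms(3) sub
      by (metis subspace_add subspace_diff subspace_mul)
  qed
  then show "gen_span (cross_maps (pairs_within U E \<union> U e \<times> U f)) q \<subseteq> W"
    unfolding gen_span_cross_maps
    by (intro span_minimal sub) (auto simp: pairs_within_def cross_map_in_W)
qed

text \<open>For every direction r the derivative \<Sum> (r . u_e) x_e - (r . x_e) u_e lies in
  \<open>W\<close>. Pairing with \<open>a\<close> kills the first terms, since x_e lies in
  \<open>W\<close>, and leaves r . (\<Sum> (a . u_e) x_e) = 0.\<close>

lemma relation_weighted:
  assumes x: "\<And>e. e \<in> E \<Longrightarrow> x e \<in> H e" "(\<Sum>e\<in>E. x e) = 0"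
    and a: "\<And>w. w \<in> W \<Longrightarrow> a \<bullet> w = 0"
  shows "(\<Sum>e\<in>E. (a \<bullet> u e) *\<^sub>R x e) = 0" (is "?z = 0")
proof -
  have "?z \<bullet> r = 0" for r
  proof -
    have "(\<Sum>e\<in>E. 1 *\<^sub>R cross_map (x e) (u e) r) \<in> gen_span (cross_maps (pairs_within U E)) q"
    proof (rule gen_span_derivative[OF linear_cross_maps max_dim])
      show "cross_map (x e) (u e) \<in> cross_maps (pairs_within U E)" if "e \<in> E" for e
        using x(1)[OF that] u_in[OF that] that
        by (auto simp: cross_maps_def pairs_within_def H_def intro!: image_eqI[of _ _ "(x e, u e)"])
      show "(\<Sum>e\<in>E. 1 *\<^sub>R cross_map (x e) (u e) q) = 0"
        using x by (simp add: cross_map_u)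
    qed assumption
    then have "a \<bullet> (\<Sum>e\<in>E. cross_map (x e) (u e) r) = 0"
      using a by (simp add: gen_span_within)
    then have "(\<Sum>e\<in>E. (r \<bullet> u e) * (a \<bullet> x e) - (r \<bullet> x e) * (a \<bullet> u e)) = 0"
      by (simp add: cross_map_def inner_sum_right inner_diff_right)
    moreover have "a \<bullet> x e = 0" if "e \<in> E" for e
      using that a H_sub_W x(1) by blast
    ultimately have "(\<Sum>e\<in>E. (r \<bullet> x e) * (a \<bullet> u e)) = 0"
      by (simp add: sum_negf)
    then show ?thesis by (simp add: inner_sum_right inner_commute[of _ r] mult.commute)
  qed
  then show ?thesis by (metis inner_eq_zero_iff)
qed

text \<open>u e0 - u f0 is the value at \<open>q\<close> of \<open>cross_map (u e0) (u f0)\<close>,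
  so its expansion into sections is a relation that can be differentiated. As \<open>a\<close>
  agrees on \<open>u e0\<close> and \<open>u f0\<close>, the extra term becomes
  \<open>a . u e0\<close> times the sum of the \<open>x e\<close>, which shifts the weights.\<close>

lemma relation_weighted_pair:
  assumes ef: "e0 \<in> E" "f0 \<in> E"
    and x: "\<And>e. e \<in> E \<Longrightarrow> x e \<in> H e" "(\<Sum>e\<in>E. x e) = u e0 - u f0"
    and a: "\<And>w. w \<in> W \<Longrightarrow> a \<bullet> w = 0"
  shows "(\<Sum>e\<in>E. (a \<bullet> (u e - u e0)) *\<^sub>R x e) = 0" (is "?z = 0")
proof -
  have uW: "u e0 - u f0 \<in> W" using x unfolding W_sums by force
  then have au: "a \<bullet> u f0 = a \<bullet> u e0" using a[OF uW] by (simp add: inner_diff_right)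
  let ?G = "cross_maps (pairs_within U E \<union> U e0 \<times> U f0)"
  \<comment> \<open>\<open>None\<close> indexes the mixed cross map; its coefficient -1 makes the
    combination vanish at \<open>q\<close>.\<close>
  let ?g = "\<lambda>i. case i of None \<Rightarrow> cross_map (u e0) (u f0) | Some e \<Rightarrow> cross_map (x e) (u e)"
  let ?c = "\<lambda>i. if i = None then -1 else (1 :: real)"
  let ?I = "insert None (Some ` E)"
  have sum_I: "(\<Sum>i\<in>?I. ?c i *\<^sub>R ?g i r) = (\<Sum>e\<in>E. cross_map (x e) (u e) r) - cross_map (u e0) (u f0) r" for r
    using finite_E by (simp add: sum.reindex)
  have "?z \<bullet> r = 0" for r
  proof -
    have "(\<Sum>i\<in>?I. ?c i *\<^sub>R ?g i r) \<in> gen_span ?G q"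
    proof (rule gen_span_derivative[OF linear_cross_maps max_dim_pair[OF ef]])
      show "?g i \<in> ?G" if "i \<in> ?I" for i
      proof (cases i)
        case None
        then show ?thesis using u_in ef
          by (auto simp: cross_maps_def intro!: image_eqI[of _ _ "(u e0, u f0)"])
      next
        case (Some e)
        then show ?thesis using that x(1) u_in
          by (auto simp: cross_maps_def pairs_within_def H_def intro!: image_eqI[of _ _ "(x e, u e)"])
      qed
      show "(\<Sum>i\<in>?I. ?c i *\<^sub>R ?g i q) = 0"
        using x ef unfolding sum_I by (simp add: cross_map_u) (simp add: cross_map_def q_u)
    qed assumption
    then have "a \<bullet> ((\<Sum>e\<in>E. cross_map (x e) (u e) r) - cross_map (u e0) (u f0) r) = 0"
      using a unfolding gen_span_pair[OF ef uW] sum_I by blast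
    then have "(\<Sum>e\<in>E. (r \<bullet> u e) * (a \<bullet> x e) - (r \<bullet> x e) * (a \<bullet> u e)) =
        (r \<bullet> u f0) * (a \<bullet> u e0) - (r \<bullet> u e0) * (a \<bullet> u e0)"
      by (simp add: cross_map_def inner_sum_right inner_diff_right au)
    moreover have "a \<bullet> x e = 0" if "e \<in> E" for e
      using that a H_sub_W x(1) by blast
    ultimately have "(\<Sum>e\<in>E. (r \<bullet> x e) * (a \<bullet> u e)) = (a \<bullet> u e0) * (r \<bullet> (u e0 - u f0))"
      by (simp add: sum_negf inner_diff_right algebra_simps)
    also have "\<dots> = (\<Sum>e\<in>E. (r \<bullet> x e) * (a \<bullet> u e0))"
      unfolding x(2)[symmetric] by (simp add: inner_sum_right sum_distrib_left mult.commute)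
    finally show ?thesis
      by (simp add: inner_sum_right inner_commute[of _ r] mult.commute inner_diff_right right_diff_distrib sum_subtractf)
  qed
  then show ?thesis by (metis inner_eq_zero_iff)
qed

lemma separating_functional:
  assumes "z \<notin> W"
  obtains a where "\<And>w. w \<in> W \<Longrightarrow> a \<bullet> w = 0" "a \<bullet> z \<noteq> 0"
proof -
  obtain y a where ya: "y \<in> span W" "\<And>w. w \<in> span W \<Longrightarrow> orthogonal a w" "z = y + a"
    using orthogonal_subspace_decomp_exists[of W z] by metis
  have sW: "span W = W" by (simp add: W_def)
  have "a \<bullet> z = a \<bullet> a" using ya by (simp add: inner_add_right orthogonal_def)
  moreover have "a \<noteq> 0" using ya assms sW by auto
  ultimately show ?thesis using ya(2) that[of a] sW by (simp add: orthogonal_def)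
qed

text \<open>
  Relations may be multiplied by any linear functional of \<open>u e\<close> modulo \<open>W\<close>, hence by any polynomial in
  such functionals; an interpolating polynomial isolates one class.
\<close>

lemma relation_class:
  assumes x: "\<And>e. e \<in> E \<Longrightarrow> x e \<in> H e" "(\<Sum>e\<in>E. x e) = 0" and f: "f \<in> E"
  shows "(\<Sum>e\<in>cls f. x e) = 0"
proof -
  have "\<exists>c. (\<Sum>e\<in>E. c e *\<^sub>R x e) = 0 \<and> (\<forall>e\<in>S. c e = 0) \<and> (\<forall>e\<in>cls f. c e = 1)"
    if "finite S" "S \<subseteq> E - cls f" for S
    using that
  proof (induction S rule: finite_induct)
    case empty
    show ?case using x(2) by (intro exI[of _ "\<lambda>_. 1"]) simp
  next
    case (insert d S)
    then obtain c where c: "(\<Sum>e\<in>E. c e *\<^sub>R x e) = 0" "\<forall>e\<in>S. c e = 0" "\<forall>e\<in>cls f. c e = 1"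
      by auto
    have "u d - u f \<notin> W" using insert.prems by (auto simp: cls_def)
    then obtain a where a: "\<And>w. w \<in> W \<Longrightarrow> a \<bullet> w = 0" "a \<bullet> (u d - u f) \<noteq> 0"
      by (rule separating_functional) blast
    let ?k = "a \<bullet> (u f - u d)"
    have k: "?k \<noteq> 0" using a(2) by (simp add: inner_diff_right)
    \<comment> \<open>A Lagrange factor: it vanishes at \<open>d\<close> and equals 1 on the class
      of \<open>f\<close>, because \<open>a\<close> is constant there.\<close>
    define c' where "c' = (\<lambda>e. c e * (a \<bullet> (u e - u d)) / ?k)"
    have "(\<Sum>e\<in>E. (a \<bullet> u e) *\<^sub>R (c e *\<^sub>R x e)) = 0"
      using x(1) c(1) a(1) by (intro relation_weighted) (auto intro: subspace_mul subspace_H)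
    then have "(\<Sum>e\<in>E. (a \<bullet> u e) *\<^sub>R (c e *\<^sub>R x e)) - (a \<bullet> u d) *\<^sub>R (\<Sum>e\<in>E. c e *\<^sub>R x e) = 0"
      using c(1) by simp
    then have "(\<Sum>e\<in>E. (c e * (a \<bullet> (u e - u d))) *\<^sub>R x e) = 0"
      by (simp add: scaleR_right.sum sum_subtractf[symmetric] inner_diff_right algebra_simps)
    then have "(1 / ?k) *\<^sub>R (\<Sum>e\<in>E. (c e * (a \<bullet> (u e - u d))) *\<^sub>R x e) = 0"
      by simp
    then have "(\<Sum>e\<in>E. c' e *\<^sub>R x e) = 0"
      unfolding scaleR_right.sum by (simp add: c'_def)
    moreover have "c' e = 1" if "e \<in> cls f" for e
    proof -
      have "a \<bullet> (u e - u f) = 0" using that a(1) by (auto simp: cls_def)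
      then show ?thesis using k c(3) that by (simp add: c'_def inner_diff_right)
    qed
    moreover have "c' e = 0" if "e \<in> insert d S" for e
      using that c(2) by (auto simp: c'_def)
    ultimately show ?case by blast
  qed
  from this[of "E - cls f"] finite_E obtain c where
    c: "(\<Sum>e\<in>E. c e *\<^sub>R x e) = 0" "\<forall>e\<in>E - cls f. c e = 0" "\<forall>e\<in>cls f. c e = 1"
    by auto
  have "(\<Sum>e\<in>cls f. x e) = (\<Sum>e\<in>E. c e *\<^sub>R x e)"
    using c finite_E by (intro sum.mono_neutral_cong_left) (auto simp: cls_def)
  then show ?thesis using c by simp
qed

lemma cls_self: "f \<in> E \<Longrightarrow> f \<in> cls f"
  by (simp add: cls_def W_def span_zero)

lemma cls_eq:
  assumes "e \<in> cls f"
  shows "cls e = cls f"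
proof -
  have "u e - u f \<in> W" using assms by (simp add: cls_def)
  moreover have "subspace W" by (simp add: W_def)
  ultimately have "u d - u e \<in> W \<longleftrightarrow> u d - u f \<in> W" for d
    using subspace_add[of W "u d - u e" "u e - u f"] subspace_diff[of W "u d - u f" "u e - u f"]
    by auto
  then show ?thesis by (simp add: cls_def)
qed

lemma partition_cls: "partition_on E (cls ` E)"
proof (rule partition_onI)
  show "\<Union> (cls ` E) = E" using cls_self by (auto simp: cls_def)
  show "disjnt C D" if "C \<in> cls ` E" "D \<in> cls ` E" "C \<noteq> D" for C D
    using that cls_eq by (auto simp: disjnt_def) blast+
  show "{} \<notin> cls ` E" using cls_self by auto
qed

lemma sum_classes: "(\<Sum>e\<in>E. x e) = (\<Sum>C\<in>cls ` E. \<Sum>e\<in>C. x e)"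
proof -
  have "(\<Sum>e\<in>E. x e) = sum x (\<Union>(cls ` E))"
    using partition_cls by (simp add: partition_on_def)
  also have "\<dots> = (\<Sum>C\<in>cls ` E. \<Sum>e\<in>C. x e)"
    using finite_E partition_cls
    by (subst sum.Union_disjoint) (auto simp: partition_on_def disjoint_def cls_def)
  finally show ?thesis .
qed

text \<open>In an expansion of the difference over all of \<open>E\<close>, the weights a . (u e - u
  e0) give a true relation. Restricted to another class they are a constant, nonzero for a
  separating \<open>a\<close>, so that class contributes 0 to the expansion.\<close>

lemma u_diff_in_class_span:
  assumes "e0 \<in> E" "f0 \<in> cls e0"
  shows "u e0 - u f0 \<in> span (\<Union>e\<in>cls e0. H e)"
proof -
  have f0: "f0 \<in> E" using assms by (simp add: cls_def)
  have "u f0 - u e0 \<in> W" using assms by (simp add: cls_def)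
  then have "u e0 - u f0 \<in> W" unfolding W_def by (metis minus_diff_eq span_neg)
  then obtain x where x: "\<And>e. e \<in> E \<Longrightarrow> x e \<in> H e" "u e0 - u f0 = (\<Sum>e\<in>E. x e)"
    unfolding W_sums by blast
  have "(\<Sum>e\<in>C. x e) = 0" if "C \<in> cls ` E - {cls e0}" for C
  proof -
    from that obtain f where f: "f \<in> E" "C = cls f" "cls f \<noteq> cls e0" by blast
    then have "u f - u e0 \<notin> W" using cls_eq[of f e0] by (auto simp: cls_def)
    then obtain a where a: "\<And>w. w \<in> W \<Longrightarrow> a \<bullet> w = 0" "a \<bullet> (u f - u e0) \<noteq> 0"
      by (rule separating_functional) blast
    have "(\<Sum>e\<in>E. (a \<bullet> (u e - u e0)) *\<^sub>R x e) = 0"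
      using relation_weighted_pair[OF assms(1) f0 x(1) x(2)[symmetric] a(1)] by blast
    then have "(\<Sum>e\<in>C. (a \<bullet> (u e - u e0)) *\<^sub>R x e) = 0"
      unfolding f(2) using x(1) f(1) by (intro relation_class) (auto intro: subspace_mul subspace_H)
    moreover have "a \<bullet> (u e - u e0) = a \<bullet> (u f - u e0)" if "e \<in> C" for e
    proof -
      have "a \<bullet> (u e - u f) = 0" using that a(1) f by (auto simp: cls_def)
      then show ?thesis by (simp add: inner_diff_right)
    qed
    ultimately have "(a \<bullet> (u f - u e0)) *\<^sub>R (\<Sum>e\<in>C. x e) = 0"
      by (simp add: scaleR_right.sum)
    then show ?thesis using a(2) by simp
  qed
  then have "(\<Sum>e\<in>E. x e) = (\<Sum>e\<in>cls e0. x e)"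
    unfolding sum_classes using finite_E assms(1)
    by (subst sum.remove[of _ "cls e0"]) (auto intro!: sum.neutral)
  then show ?thesis
    unfolding x(2) using x(1) by (auto simp: cls_def intro!: span_sum intro: span_base)
qed

text \<open>All \<open>U e\<close> of a class lie in \<open>V C\<close> plus the line of a single
  \<open>u f\<close>, because differences of the \<open>u e\<close> lie in \<open>V C\<close>; this
  costs at most one dimension. The \<open>V C\<close> are independent by
  \<open>relation_class\<close>, so the bounds add up inside \<open>W\<close>.\<close>

lemma dim_W_ge: "(\<Sum>C\<in>cls ` E. int (dim (\<Union>e\<in>C. U e)) - 1) \<le> int (dim W)"
proof -
  define V where "V = (\<lambda>C. span (\<Union>e\<in>C. H e))"
  have "int (dim (\<Union>e\<in>C. U e)) - 1 \<le> int (dim (V C))" if C: "C \<in> cls ` E" for C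
  proof -
    obtain f where f: "f \<in> E" "C = cls f" using C by blast
    have "x \<in> span (insert (u f) (V C))" if e: "e \<in> C" "x \<in> U e" for e x
    proof -
      have eE: "e \<in> E" using e f by (simp add: cls_def)
      have "x - (q \<bullet> x) *\<^sub>R u e \<in> span (insert (u f) (V C))"
        using U_decomp[OF eE e(2)] e(1) by (auto simp: V_def intro!: span_base)
      moreover have "u f - u e \<in> span (insert (u f) (V C))"
        using u_diff_in_class_span[OF f(1), of e] e(1) f(2)
          span_base[of "u f - u e" "insert (u f) (V C)"] by (simp add: V_def)
      moreover have "u f \<in> span (insert (u f) (V C))" by (simp add: span_base)
      ultimately show ?thesis
        using span_add[OF _ span_scale[OF span_diff], of "x - (q \<bullet> x) *\<^sub>R u e" _ "u f" "u f - u e" "q \<bullet> x"]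
        by simp
    qed
    then have "dim (\<Union>e\<in>C. U e) \<le> dim (insert (u f) (V C))"
      by (metis (no_types, lifting) UN_iff dim_subset dim_span subsetI)
    also have "\<dots> \<le> dim (V C) + 1"
      by (simp add: dim_insert)
    finally show ?thesis by simp
  qed
  then have "(\<Sum>C\<in>cls ` E. int (dim (\<Union>e\<in>C. U e)) - 1) \<le> (\<Sum>C\<in>cls ` E. int (dim (V C)))"
    by (rule sum_mono)
  also have "\<dots> = int (\<Sum>C\<in>cls ` E. dim (V C))" by simp
  also have "(\<Sum>C\<in>cls ` E. dim (V C)) = dim (\<Union>C\<in>cls ` E. V C)"
  proof (rule dim_UN_direct[symmetric])
    fix y C assume y: "\<And>C. C \<in> cls ` E \<Longrightarrow> y C \<in> V C" "(\<Sum>C\<in>cls ` E. y C) = 0" "C \<in> cls ` E"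
    have "\<exists>x. (\<forall>e\<in>C. x e \<in> H e) \<and> y C = (\<Sum>e\<in>C. x e)" if "C \<in> cls ` E" for C
    proof -
      have "C \<subseteq> E" using that by (auto simp: cls_def)
      then have "V C = {\<Sum>e\<in>C. x e | x. \<forall>e\<in>C. x e \<in> H e}"
        unfolding V_def using finite_E subspace_H by (intro span_UN_eq_sums) (auto intro: finite_subset)
      then show ?thesis using y(1)[OF that] by auto
    qed
    then have "\<forall>C\<in>cls ` E. \<exists>x. (\<forall>e\<in>C. x e \<in> H e) \<and> y C = (\<Sum>e\<in>C. x e)" by blast
    from bchoice[OF this] obtain X where
      X: "\<And>C. C \<in> cls ` E \<Longrightarrow> (\<forall>e\<in>C. X C e \<in> H e) \<and> y C = (\<Sum>e\<in>C. X C e)" by blast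
    \<comment> \<open>Each edge lies in exactly one class, so the representations of the
      \<open>y C\<close> glue to one relation over \<open>E\<close>.\<close>
    define x where "x = (\<lambda>e. X (cls e) e)"
    have yC: "y C = (\<Sum>e\<in>C. x e)" if "C \<in> cls ` E" for C
    proof -
      have "cls e = C" if "e \<in> C" for e using that \<open>C \<in> cls ` E\<close> cls_eq by auto
      then show ?thesis using X[OF that] by (simp add: x_def)
    qed
    have "(\<Sum>e\<in>E. x e) = 0" unfolding sum_classes using y(2) yC by simp
    moreover have "x e \<in> H e" if "e \<in> E" for e
      using X[of "cls e"] that cls_self by (auto simp: x_def)
    ultimately show "y C = 0" using y(3) yC relation_class by auto
  qed (auto simp: V_def finite_E)
  also have "\<dots> \<le> dim W"
  proof (rule dim_subset)
    have "V (cls f) \<subseteq> W" for f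
      unfolding V_def W_def by (rule span_mono) (auto simp: cls_def)
    then show "(\<Union>C\<in>cls ` E. V C) \<subseteq> W" by blast
  qed
  finally show ?thesis by simp
qed

text \<open>On each block \<open>q\<close> annihilates the sections but not \<open>u e\<close>, so
  the sections span a proper subspace of the span of the \<open>U e\<close>; at least one dimension
  is lost per block.\<close>

lemma dim_W_le:
  assumes P: "partition_on E P"
  shows "int (dim W) \<le> (\<Sum>X\<in>P. int (dim (\<Union>e\<in>X. U e)) - 1)"
proof -
  have fin: "finite P" using P finite_E by (rule finite_elements[rotated])
  have "W = span (\<Union>X\<in>P. \<Union>e\<in>X. H e)"
    unfolding W_def using P by (auto simp: partition_on_def)
  then have "dim W = dim (\<Union>X\<in>P. \<Union>e\<in>X. H e)" by simp
  also have "\<dots> \<le> (\<Sum>X\<in>P. dim (\<Union>e\<in>X. H e))" by (rule dim_UN_le[OF fin])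
  finally have "int (dim W) \<le> (\<Sum>X\<in>P. int (dim (\<Union>e\<in>X. H e)))"
    unfolding of_nat_sum[symmetric] by (rule of_nat_mono)
  also have "\<dots> \<le> (\<Sum>X\<in>P. int (dim (\<Union>e\<in>X. U e)) - 1)"
  proof (rule sum_mono)
    fix X assume X: "X \<in> P"
    then obtain e where e: "e \<in> X" using P by (metis partition_on_def all_not_in_conv)
    then have eE: "e \<in> E" using P X by (auto simp: partition_on_def)
    have "q \<bullet> x = 0" if "x \<in> span (\<Union>e\<in>X. H e)" for x
      using that by (rule span_induct) (auto simp: H_def subspace_hyperplane)
    then have "u e \<notin> span (\<Union>e\<in>X. H e)" using q_u[OF eE] by auto
    moreover have "u e \<in> span (\<Union>e\<in>X. U e)" using u_in[OF eE] e by (auto intro!: span_base)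
    moreover have "span (\<Union>e\<in>X. H e) \<subseteq> span (\<Union>e\<in>X. U e)" by (rule span_mono) (auto simp: H_def)
    ultimately have "dim (\<Union>e\<in>X. H e) < dim (\<Union>e\<in>X. U e)" by (intro dim_psubset) auto
    then show "int (dim (\<Union>e\<in>X. H e)) \<le> int (dim (\<Union>e\<in>X. U e)) - 1" by simp
  qed
  finally show ?thesis .
qed

end

section \<open>Edge spaces under switching and contraction\<close>

lemma dim_image_kernel:
  fixes f :: "'a::euclidean_space \<Rightarrow> 'b::euclidean_space"
  assumes f: "linear f" and S: "subspace S"
  shows "dim S = dim (f ` S) + dim {x \<in> S. f x = 0}"
proof -
  let ?K = "{x \<in> S. f x = 0}" and ?C = "{y \<in> S. \<forall>x\<in>{x \<in> S. f x = 0}. orthogonal x y}"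
  have K: "subspace ?K"
    using S f by (auto simp: subspace_def linear_0 linear_add linear_scale)
  have C: "subspace ?C"
    using S by (auto simp: subspace_def orthogonal_def inner_simps)
  have "inj_on f ?C"
  proof (rule inj_onI)
    fix x y assume xy: "x \<in> ?C" "y \<in> ?C" "f x = f y"
    then have "x - y \<in> ?C" using C by (simp only: subspace_diff)
    moreover have "x - y \<in> ?K" using xy S f by (simp add: subspace_diff linear_diff)
    ultimately have "orthogonal (x - y) (x - y)" by blast
    then show "x = y" by (simp add: orthogonal_def)
  qed
  then have "dim (f ` ?C) = dim ?C"
    using f C by (intro dim_image_eq) (simp_all add: span_eq_iff[THEN iffD2])
  moreover have "f ` ?C = f ` S"
  proof (intro equalityI subsetI)
    fix z assume "z \<in> f ` S"
    then obtain x where x: "x \<in> S" "z = f x" by blast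
    obtain y w where yw: "y \<in> span ?K" "\<And>v. v \<in> span ?K \<Longrightarrow> orthogonal w v" "x = y + w"
      by (rule orthogonal_subspace_decomp_exists[of ?K x]) blast
    have y: "y \<in> ?K" using yw(1) K by (simp only: span_eq_iff[THEN iffD2])
    have "w \<in> S" using yw(3) x(1) y S by (metis (no_types, lifting) add_diff_cancel_left' mem_Collect_eq subspace_diff)
    then have "w \<in> ?C" using yw(2) by (auto simp: orthogonal_commute intro: span_base)
    moreover have "z = f w" using x(2) yw(3) y f by (simp add: linear_add)
    ultimately show "z \<in> f ` ?C" by blast
  qed blast
  moreover have "dim ?C + dim ?K = dim S"
    by (rule dim_subspace_orthogonal_to_vectors[OF K S]) blast
  ultimately show ?thesis by simp
qed

section \<open>Maximal forests and connectivity\<close>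

abbreviation conn :: "('e \<Rightarrow> 'v) \<Rightarrow> ('e \<Rightarrow> 'v) \<Rightarrow> 'e set \<Rightarrow> ('v \<times> 'v) set" where
  "conn tail head F \<equiv> ({(tail e, head e) | e. e \<in> F} \<union> {(head e, tail e) | e. e \<in> F})\<^sup>*"

lemma sym_conn: "sym (conn tail head F)"
  by (rule sym_rtrancl) (auto simp: sym_def)

lemma conn_edge: "e \<in> F \<Longrightarrow> (tail e, head e) \<in> conn tail head F"
  by (rule r_into_rtrancl) blast

text \<open>A cycle without \<open>e\<close> is a path in \<open>T\<close> joining the ends of
  \<open>e\<close>; for a loop this path is empty.\<close>

lemma cycle_in_connected:
  assumes c: "cycle_in tail head (insert e T) vs es" and "e \<in> set es"
  shows "(tail e, head e) \<in> conn tail head T"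
proof -
  let ?n = "length es"
  obtain k where k: "k < ?n" "es ! k = e" using assms(2) by (metis in_set_conv_nth)
  then have n: "?n > 0" by linarith
  have step: "(vs ! i, vs ! (Suc i mod ?n)) \<in> conn tail head T" if i: "i < ?n" "i \<noteq> k" for i
  proof -
    have "es ! i \<noteq> e"
      using c k i by (metis cycle_in_def nth_eq_iff_index_eq)
    then have "es ! i \<in> T" using c i by (auto simp: cycle_in_def dest: nth_mem)
    then have "(tail (es ! i), head (es ! i)) \<in> conn tail head T"
      by (rule conn_edge)
    moreover from this have "(head (es ! i), tail (es ! i)) \<in> conn tail head T"
      by (rule symD[OF sym_conn])
    moreover have "{tail (es ! i), head (es ! i)} = {vs ! i, vs ! (Suc i mod ?n)}"
      using c i by (auto simp: cycle_in_def)
    ultimately show ?thesis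
      unfolding doubleton_eq_iff by auto
  qed
  \<comment> \<open>The walk starts just past the position \<open>k\<close> of \<open>e\<close> and
    reaches \<open>vs ! k\<close> after n - 1 steps.\<close>
  have "(vs ! (Suc k mod ?n), vs ! ((Suc k + m) mod ?n)) \<in> conn tail head T" if "m < ?n" for m
    using that
  proof (induction m)
    case (Suc m)
    \<comment> \<open>Position \<open>k\<close> is met only at m = n - 1, so every edge used before
      that differs from \<open>e\<close>.\<close>
    have "(Suc k + m) mod ?n \<noteq> k"
    proof (cases "Suc k + m < ?n")
      case False
      then have "(Suc k + m) mod ?n = Suc k + m - ?n"
        using k Suc.prems by (simp add: le_mod_geq)
      then show ?thesis using False Suc.prems by linarith
    qed simp
    then have "(vs ! ((Suc k + m) mod ?n), vs ! (Suc ((Suc k + m) mod ?n) mod ?n)) \<in> conn tail head T"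
      by (intro step mod_less_divisor n)
    moreover have "Suc ((Suc k + m) mod ?n) mod ?n = (Suc k + Suc m) mod ?n"
      by (simp add: mod_Suc_eq)
    ultimately show ?case using Suc.IH[OF Suc_lessD[OF Suc.prems]] rtrancl_trans by fastforce
  qed simp
  from this[of "?n - 1"] have "(vs ! (Suc k mod ?n), vs ! k) \<in> conn tail head T"
    using n k by simp
  moreover from this have "(vs ! k, vs ! (Suc k mod ?n)) \<in> conn tail head T"
    by (rule symD[OF sym_conn])
  moreover have "{tail e, head e} = {vs ! k, vs ! (Suc k mod ?n)}"
    using c k by (auto simp: cycle_in_def)
  ultimately show ?thesis
    unfolding doubleton_eq_iff by auto
qed

text \<open>By maximality an edge of \<open>F - T\<close> closes a cycle with \<open>T\<close>. The
  cycle passes through that edge because \<open>T\<close> has none, so its ends are already joined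
  in \<open>T\<close>.\<close>

lemma maximal_forest_conn:
  assumes "maximal_forest tail head F T"
  shows "conn tail head F \<subseteq> conn tail head T"
proof -
  have e: "(tail e, head e) \<in> conn tail head T" if "e \<in> F" for e
  proof (cases "e \<in> T")
    case False
    then have "\<not> edge_forest tail head (insert e T)"
      using assms that by (simp add: maximal_forest_def)
    then obtain vs es where c: "cycle_in tail head (insert e T) vs es"
      by (auto simp: edge_forest_def)
    moreover have "\<not> cycle_in tail head T vs es"
      using assms by (auto simp: maximal_forest_def edge_forest_def)
    ultimately have "e \<in> set es" by (auto simp: cycle_in_def)
    with c show ?thesis by (rule cycle_in_connected)
  qed (rule conn_edge)
  have "(head e, tail e) \<in> conn tail head T" if "e \<in> F" for e
    using e[OF that] by (rule symD[OF sym_conn])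
  with e have "{(tail e, head e) | e. e \<in> F} \<union> {(head e, tail e) | e. e \<in> F} \<subseteq> conn tail head T"
    by blast
  then show ?thesis by (rule rtrancl_subset_rtrancl)
qed

lemma component_of_eq_iff:
  "component_of tail head F v = component_of tail head F w \<longleftrightarrow> (v, w) \<in> conn tail head F"
proof
  assume "component_of tail head F v = component_of tail head F w"
  then show "(v, w) \<in> conn tail head F" by (auto simp: component_of_def set_eq_iff)
next
  assume vw: "(v, w) \<in> conn tail head F"
  then have wv: "(w, v) \<in> conn tail head F" by (rule symD[OF sym_conn])
  show "component_of tail head F v = component_of tail head F w"
    unfolding component_of_def
    using rtrancl_trans[OF vw] rtrancl_trans[OF wv] by blast
qed

section \<open>Edge vectors and the hyperplane of a placement\<close>

lemma matrix_inv_inverse: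
  fixes A :: "real^'n^'n"
  assumes "invertible A"
  shows "A ** matrix_inv A = mat 1" "matrix_inv A ** A = mat 1"
  using someI_ex[OF assms[unfolded invertible_def]] unfolding matrix_inv_def by auto

lemma matrix_inv_orthogonal:
  fixes A :: "real^'n^'n"
  assumes "orthogonal_matrix A"
  shows "matrix_inv A = transpose A"
proof -
  have "invertible A" using assms by (auto simp: invertible_def orthogonal_matrix_def)
  then have "matrix_inv A ** (A ** transpose A) = transpose A"
    by (simp add: matrix_mul_assoc matrix_inv_inverse)
  then show ?thesis using assms by (simp add: orthogonal_matrix_def)
qed

lemma orthogonal_matrix_cancel:
  fixes A :: "real^'n^'n"
  assumes "orthogonal_matrix A"
  shows "(A *v x) v* A = x" "A *v (x v* A) = x"
proof -
  have "transpose A *v (A *v x) = x" "A *v (transpose A *v x) = x"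
    using assms unfolding matrix_vector_mul_assoc orthogonal_matrix_def by simp_all
  then show "(A *v x) v* A = x" "A *v (x v* A) = x" by simp_all
qed

lemma mult_euclidean_group:
  "\<gamma> \<otimes>\<^bsub>euclidean_group\<^esub> \<delta> = (fst \<gamma> ** fst \<delta>, fst \<gamma> *v snd \<delta> + snd \<gamma>)"
  by (simp add: euclidean_group_def)

text \<open>
  Both kinds of edges have the same parametrization: for a non-loop, \<open>\<alpha> = x(i)\<close>.
\<close>

definition edge_vec ::
    "('k::finite \<Rightarrow> real^'n::finite^'n) \<Rightarrow> real^'n^'n \<Rightarrow> 'w::finite \<Rightarrow> 'w \<Rightarrow> 'n isometry \<Rightarrow> real^'n
     \<Rightarrow> (real^'n^'w) \<times> (real^'k)" where
  "edge_vec Bs B i j \<gamma> \<alpha> = (axis i \<alpha> - axis j (\<alpha> v* fst \<gamma>), - b_map Bs B \<alpha> (snd \<gamma>))"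

lemma linear_axis: "linear (axis i :: 'a::real_vector \<Rightarrow> 'a^'n)"
  by (rule linearI) (simp_all add: vec_eq_iff axis_def)

lemma linear_b_map: "linear (\<lambda>\<alpha>. b_map Bs B \<alpha> t)"
  by (rule linearI) (simp_all add: b_map_def vec_eq_iff inner_simps)

lemma linear_vector_matrix: "linear (\<lambda>x :: real^'m. x v* A)"
  by (rule linearI) (simp_all add: vector_matrix_left_distrib scaleR_vector_matrix_assoc)

lemma linear_edge_vec: "linear (edge_vec Bs B i j \<gamma>)"
  by (rule linearI) (simp_all add: edge_vec_def linear_add[OF linear_axis] linear_scale[OF linear_axis]
      linear_add[OF linear_b_map] linear_scale[OF linear_b_map] linear_add[OF linear_vector_matrix]
      linear_scale[OF linear_vector_matrix] algebra_simps)

text \<open>\<open>\<alpha> v* A\<close> is the transpose of \<open>A\<close> applied to \<alpha>,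
  hence A^-1 \<alpha> for orthogonal \<open>A\<close>; the loop block I - A^-1 is thus the case i =
  j of the non-loop vector.\<close>

lemma edge_vec_loop:
  assumes "orthogonal_matrix (fst \<gamma>)"
  shows "loop_vec Bs B i \<gamma> \<alpha> = edge_vec Bs B i i \<gamma> \<alpha>"
  using assms by (simp add: loop_vec_def edge_vec_def vec_eq_iff axis_def matrix_inv_orthogonal
      matrix_vector_mult_diff_rdistrib)

lemma edge_U_eq_range:
  assumes "orthogonal_matrix (fst \<gamma>)"
  shows "edge_U Bs B i j \<gamma> = range (edge_vec Bs B i j \<gamma>)"
proof (cases "i = j")
  case True
  then show ?thesis by (auto simp: edge_U_def edge_vec_loop[OF assms])
next
  case False
  have "x = edge_vec Bs B i j \<gamma> (fst x $ i)"
    if x: "fst x $ i + fst \<gamma> *v (fst x $ j) = 0" "b_map Bs B (fst x $ i) (snd \<gamma>) + snd x = 0"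
      "vanishes_off {i, j} x" for x
  proof (rule prod_eqI)
    have "fst \<gamma> *v (fst x $ j) = - (fst x $ i)" using x(1) by (simp add: add_eq_0_iff)
    then have "(- (fst x $ i)) v* fst \<gamma> = fst x $ j"
      using orthogonal_matrix_cancel(1)[OF assms, of "fst x $ j"] by simp
    then have "fst x $ j = - ((fst x $ i) v* fst \<gamma>)"
      using linear_neg[OF linear_vector_matrix] by metis
    then show "fst x = fst (edge_vec Bs B i j \<gamma> (fst x $ i))"
      using x(3) False by (auto simp: edge_vec_def vec_eq_iff axis_def vanishes_off_def)
    show "snd x = snd (edge_vec Bs B i j \<gamma> (fst x $ i))"
      using x(2) by (simp add: edge_vec_def add_eq_0_iff2)
  qed
  moreover have "edge_vec Bs B i j \<gamma> \<alpha> \<in> edge_U Bs B i j \<gamma>" for \<alpha>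
    using False by (simp add: edge_U_def edge_vec_def axis_def vanishes_off_def
        linear_neg[OF matrix_vector_mul_linear] orthogonal_matrix_cancel[OF assms])
  ultimately show ?thesis using False by (auto simp: edge_U_def)
qed

lemma linear_matrix_vector: "linear (\<lambda>M :: real^'m^'n. M *v y)"
  by (rule linearI) (simp_all add: matrix_vector_mult_add_rdistrib scaleR_matrix_vector_assoc)

text \<open>The matrices \<open>Bs l ** matrix_inv B\<close> weighted by \<open>s\<close> sum to the
  identity, so \<open>s\<close> paired with \<open>b(\<alpha>, t)\<close> is just \<alpha> . t. This
  makes the lattice coordinates the last component of the normal vector.\<close>

lemma inner_edge_vec:
  assumes s: "B = (\<Sum>l\<in>UNIV. s $ l *\<^sub>R Bs l)" and inv: "invertible B"
  shows "(p, s) \<bullet> edge_vec Bs B i j \<gamma> \<alpha> = (p $ i - (fst \<gamma> *v (p $ j) + snd \<gamma>)) \<bullet> \<alpha>"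
proof -
  have "(\<Sum>l\<in>UNIV. s $ l *\<^sub>R ((Bs l ** matrix_inv B) *v snd \<gamma>)) = (\<Sum>l\<in>UNIV. s $ l *\<^sub>R Bs l) *v (matrix_inv B *v snd \<gamma>)"
    by (simp add: matrix_vector_mul_assoc[symmetric] linear_sum[OF linear_matrix_vector] scaleR_matrix_vector_assoc)
  also have "\<dots> = snd \<gamma>"
    unfolding s[symmetric] by (simp add: matrix_vector_mul_assoc matrix_inv_inverse[OF inv])
  finally have "(\<Sum>l\<in>UNIV. s $ l *\<^sub>R ((Bs l ** matrix_inv B) *v snd \<gamma>)) \<bullet> \<alpha> = snd \<gamma> \<bullet> \<alpha>"
    by simp
  then have "s \<bullet> b_map Bs B \<alpha> (snd \<gamma>) = snd \<gamma> \<bullet> \<alpha>"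
    by (simp add: b_map_def inner_vec_def[of s] inner_commute[of \<alpha>] inner_sum_left)
  then show ?thesis
    by (simp add: edge_vec_def inner_diff_right inner_diff_left inner_axis inner_add_left
        inner_commute[of "p $ j"] dot_lmul_matrix inner_commute[of \<alpha>])
qed

lemma edge_P_eq:
  assumes o: "orthogonal_matrix (fst \<gamma>)"
    and s: "B = (\<Sum>l\<in>UNIV. s $ l *\<^sub>R Bs l)" and inv: "invertible B"
  shows "edge_P Bs B i j \<gamma> p = edge_U Bs B i j \<gamma> \<inter> {x. (p, s) \<bullet> x = 0}"
proof (cases "i = j")
  case True
  then show ?thesis
    by (auto simp: edge_P_def edge_U_def edge_vec_loop[OF o] inner_edge_vec[OF s inv])
next
  case False
  have "fst (edge_vec Bs B i j \<gamma> \<alpha>) $ i = \<alpha>" for \<alpha>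
    using False by (simp add: edge_vec_def axis_def)
  then show ?thesis
    using False unfolding edge_P_def edge_U_eq_range[OF o]
    by (auto simp: inner_edge_vec[OF s inv])
qed

text \<open>Switching rests on this commutation: it gives b(\<alpha>, A t) = b(A^T \<alpha>, t) for
  \<open>A\<close> in the point group.\<close>

locale periodic_gains =
  fixes \<Gamma> :: "'n::finite isometry set" and B :: "real^'n^'n" and Bs :: "'k::finite \<Rightarrow> real^'n^'n"
  assumes subgroup_\<Gamma>: "subgroup \<Gamma> euclidean_group"
    and commutes: "\<And>\<gamma> l. \<gamma> \<in> \<Gamma> \<Longrightarrow> (Bs l ** matrix_inv B) ** fst \<gamma> = fst \<gamma> ** (Bs l ** matrix_inv B)"
begin

lemma orthogonal_\<Gamma>: "\<gamma> \<in> \<Gamma> \<Longrightarrow> orthogonal_matrix (fst \<gamma>)"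
  using subgroup.subset[OF subgroup_\<Gamma>] by (auto simp: euclidean_group_def)

lemma mult_\<Gamma>: "\<gamma> \<in> \<Gamma> \<Longrightarrow> \<delta> \<in> \<Gamma> \<Longrightarrow> \<gamma> \<otimes>\<^bsub>euclidean_group\<^esub> \<delta> \<in> \<Gamma>"
  by (rule subgroup.m_closed[OF subgroup_\<Gamma>])

lemma inv_\<Gamma>: "\<gamma> \<in> \<Gamma> \<Longrightarrow> inv\<^bsub>euclidean_group\<^esub> \<gamma> \<in> \<Gamma>"
  by (rule subgroup.m_inv_closed[OF subgroup_\<Gamma>])

lemma b_map_add: "b_map Bs B \<alpha> (t + u) = b_map Bs B \<alpha> t + b_map Bs B \<alpha> u"
  by (simp add: b_map_def vec_eq_iff matrix_vector_right_distrib inner_add_right)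

lemma b_map_diff: "b_map Bs B \<alpha> (t - u) = b_map Bs B \<alpha> t - b_map Bs B \<alpha> u"
  by (simp add: b_map_def vec_eq_iff matrix_vector_mult_diff_distrib inner_diff_right)

lemma b_map_uminus: "b_map Bs B \<alpha> (- t) = - b_map Bs B \<alpha> t"
  by (simp add: b_map_def vec_eq_iff linear_neg[OF matrix_vector_mul_linear])

lemma b_map_rotate: "\<gamma> \<in> \<Gamma> \<Longrightarrow> b_map Bs B \<alpha> (fst \<gamma> *v t) = b_map Bs B (\<alpha> v* fst \<gamma>) t"
  by (simp add: b_map_def vec_eq_iff matrix_vector_mul_assoc commutes dot_lmul_matrix)

lemma b_map_rotate_inverse:
  assumes "\<gamma> \<in> \<Gamma>"
  shows "b_map Bs B \<alpha> (t v* fst \<gamma>) = b_map Bs B (fst \<gamma> *v \<alpha>) t"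
  using b_map_rotate[OF assms, of "fst \<gamma> *v \<alpha>" "t v* fst \<gamma>"]
  by (simp add: orthogonal_matrix_cancel[OF orthogonal_\<Gamma>[OF assms]])

text \<open>With \<open>\<gamma> = (C, u)\<close>: x(v) becomes C x(v), and the star part loses b(C
  x(v), u). For an edge out of \<open>v\<close> with gain (A, t) this matches the new gain (C A, C t
  + u) with parameter C \<alpha>, as b(C \<alpha>, C t) = b(\<alpha>, t). The map does not depend on
  the edge.\<close>

definition switch_map :: "'w::finite \<Rightarrow> 'n isometry \<Rightarrow> (real^'n^'w) \<times> (real^'k) \<Rightarrow> (real^'n^'w) \<times> (real^'k)" where
  "switch_map v \<gamma> x = (fst x + axis v (fst \<gamma> *v (fst x $ v) - fst x $ v),
     snd x - b_map Bs B (fst \<gamma> *v (fst x $ v)) (snd \<gamma>))"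

lemma linear_switch_map: "linear (switch_map v \<gamma>)"
  by (rule linearI)
    (simp_all add: switch_map_def matrix_vector_right_distrib linear_add[OF linear_b_map] vec_eq_iff axis_def
       matrix_vector_mult_scaleR linear_scale[OF linear_b_map] algebra_simps)

lemma inj_switch_map:
  assumes "\<gamma> \<in> \<Gamma>"
  shows "inj (switch_map v \<gamma>)"
  unfolding linear_injective_0[OF linear_switch_map[of v \<gamma>]]
proof (intro allI impI)
  fix x assume x: "switch_map v \<gamma> x = 0"
  then have f: "fst x + axis v (fst \<gamma> *v (fst x $ v) - fst x $ v) = 0" by (simp add: switch_map_def prod_eq_iff)
  have w: "fst x $ w = 0" if "w \<noteq> v" for w
    using arg_cong[OF f, of "\<lambda>y. y $ w"] that by (simp add: axis_def)
  have "fst \<gamma> *v (fst x $ v) = 0"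
    using arg_cong[OF f, of "\<lambda>y. y $ v"] by (simp add: axis_def)
  then have v: "fst x $ v = 0"
    using orthogonal_matrix_cancel(1)[OF orthogonal_\<Gamma>[OF assms], of "fst x $ v"] by simp
  have "fst x $ w = 0" for w using v w by (cases "w = v") auto
  then have "fst x = 0" by (simp add: vec_eq_iff)
  then show "x = 0" using x by (simp add: switch_map_def prod_eq_iff linear_0[OF linear_b_map])
qed

text \<open>The parameter sits at the tail, so it is rotated only if \<open>v\<close> is the tail; a
  change at the head is absorbed by the new gain.\<close>

lemma switch_edge_vec:
  assumes \<gamma>: "\<gamma> \<in> \<Gamma>" and \<psi>: "\<psi> e \<in> \<Gamma>"
  shows "switch_map v \<gamma> (edge_vec Bs B (tail e) (head e) (\<psi> e) \<alpha>) =
    edge_vec Bs B (tail e) (head e) (switch tail head v \<gamma> \<psi> e) (if tail e = v then fst \<gamma> *v \<alpha> else \<alpha>)"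
proof -
  obtain C u A t where g: "\<gamma> = (C, u)" "\<psi> e = (A, t)" by (metis surj_pair)
  have C: "(C, u) \<in> \<Gamma>" and A: "(A, t) \<in> \<Gamma>" using \<gamma> \<psi> g by auto
  have o: "orthogonal_matrix C" "orthogonal_matrix A" using orthogonal_\<Gamma>[OF C] orthogonal_\<Gamma>[OF A] by auto
  note rot = b_map_rotate[OF C, simplified] b_map_rotate[OF A, simplified]
    b_map_rotate_inverse[OF C, simplified]
  note lin = linear_neg[OF matrix_vector_mul_linear] linear_diff[OF linear_b_map] linear_neg[OF linear_b_map]
    linear_0[OF linear_b_map]
  show ?thesis
    unfolding g switch_def
    by (cases "tail e = v"; cases "head e = v")
      (simp_all add: g edge_vec_def switch_map_def inv_euclidean_group[OF o(1)] mult_euclidean_group prod_eq_iff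
        vec_eq_iff axis_def b_map_add b_map_diff b_map_uminus rot orthogonal_matrix_cancel[OF o(1)] orthogonal_matrix_cancel[OF o(2)]
        vector_matrix_mul_assoc[symmetric] matrix_vector_mul_assoc[symmetric] lin algebra_simps)
qed

lemma switch_\<Gamma>: "\<gamma> \<in> \<Gamma> \<Longrightarrow> \<psi> e \<in> \<Gamma> \<Longrightarrow> switch tail head v \<gamma> \<psi> e \<in> \<Gamma>"
  by (simp add: switch_def mult_\<Gamma> inv_\<Gamma>)

lemma switch_edge_U:
  fixes tail head :: "'e \<Rightarrow> 'v::finite"
  assumes \<gamma>: "\<gamma> \<in> \<Gamma>" and \<psi>: "\<psi> e \<in> \<Gamma>"
  shows "edge_U Bs B (tail e) (head e) (switch tail head v \<gamma> \<psi> e) =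
    switch_map v \<gamma> ` edge_U Bs B (tail e) (head e) (\<psi> e)"
proof -
  have "edge_vec Bs B (tail e) (head e) (switch tail head v \<gamma> \<psi> e) \<alpha> \<in>
      switch_map v \<gamma> ` range (edge_vec Bs B (tail e) (head e) (\<psi> e))" for \<alpha>
    using switch_edge_vec[of \<gamma> \<psi> e v tail head "if tail e = v then \<alpha> v* fst \<gamma> else \<alpha>", OF \<gamma> \<psi>]
    by (cases "tail e = v")
      (auto simp: orthogonal_matrix_cancel[OF orthogonal_\<Gamma>[OF \<gamma>]] intro: image_eqI[OF sym])
  then show ?thesis
    unfolding edge_U_eq_range[OF orthogonal_\<Gamma>[OF \<psi>]]
      edge_U_eq_range[OF orthogonal_\<Gamma>[OF switch_\<Gamma>[of \<gamma> \<psi> e, OF \<gamma> \<psi>]]]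
    using switch_edge_vec[of \<gamma> \<psi> e v tail head, OF \<gamma> \<psi>] by auto
qed

lemma switchable_dim:
  fixes tail head :: "'e \<Rightarrow> 'v::finite"
  assumes "switchable \<Gamma> tail head \<psi> \<phi>" and "\<And>e. e \<in> F \<Longrightarrow> \<psi> e \<in> \<Gamma>"
  shows "(\<forall>e\<in>F. \<phi> e \<in> \<Gamma>) \<and>
    dim (\<Union>e\<in>F. edge_U Bs B (tail e) (head e) (\<phi> e)) = dim (\<Union>e\<in>F. edge_U Bs B (tail e) (head e) (\<psi> e))"
  using assms
proof (induction rule: switchable.induct)
  case (step \<phi> \<gamma> v)
  then have \<phi>: "\<forall>e\<in>F. \<phi> e \<in> \<Gamma>" by blast
  have "(\<Union>e\<in>F. edge_U Bs B (tail e) (head e) (switch tail head v \<gamma> \<phi> e)) =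
      switch_map v \<gamma> ` (\<Union>e\<in>F. edge_U Bs B (tail e) (head e) (\<phi> e))"
    unfolding image_UN using switch_edge_U[of \<gamma> \<phi> _ tail head v, OF step.hyps(2)] \<phi>
    by (intro SUP_cong HOL.refl) blast
  moreover have "\<forall>e\<in>F. switch tail head v \<gamma> \<phi> e \<in> \<Gamma>"
    using switch_\<Gamma>[of \<gamma> \<phi> _ tail head v, OF step.hyps(2)] \<phi> by blast
  ultimately show ?case
    using step.IH[OF step.prems]
    by (simp add: dim_image_eq[OF linear_switch_map inj_on_subset[OF inj_switch_map[OF step.hyps(2)] subset_UNIV]])
qed simp

end

section \<open>Contraction of the components\<close>

lemma dim_vanishes_off:
  "dim {x :: (real^'n::finite^'w::finite) \<times> (real^'k::finite). vanishes_off S x \<and> snd x = 0} = CARD('n) * card S"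
proof -
  define d where "d = (\<lambda>(w, b :: real^'n). (axis w b, 0 :: real^'k)) ` (S \<times> Basis)"
  have "(a \<in> Basis \<longrightarrow> (axis w a, 0) \<in> d) \<longleftrightarrow> (a \<in> Basis \<longrightarrow> w \<in> S)" for w :: 'w and a :: "real^'n"
    unfolding d_def by (auto simp: axis_eq_axis nonzero_Basis image_iff)
  then have d: "a \<in> Basis \<Longrightarrow> (axis w a, 0) \<in> d \<longleftrightarrow> w \<in> S" for w :: 'w and a :: "real^'n"
    by blast
  have "{x :: (real^'n^'w) \<times> (real^'k). vanishes_off S x \<and> snd x = 0} = {x. \<forall>i\<in>Basis. i \<notin> d \<longrightarrow> x \<bullet> i = 0}"
  proof (intro equalityI subsetI CollectI conjI)
    fix x :: "(real^'n^'w) \<times> (real^'k)" assume x: "x \<in> {x. vanishes_off S x \<and> snd x = 0}"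
    show "\<forall>i\<in>Basis. i \<notin> d \<longrightarrow> x \<bullet> i = 0"
      using x d by (auto simp: Basis_prod_def Basis_vec_def[where 'b = 'w] inner_prod_def inner_axis vanishes_off_def)
  next
    fix x :: "(real^'n^'w) \<times> (real^'k)" assume "x \<in> {x. \<forall>i\<in>Basis. i \<notin> d \<longrightarrow> x \<bullet> i = 0}"
    then have x: "i \<in> Basis \<Longrightarrow> i \<notin> d \<Longrightarrow> x \<bullet> i = 0" for i by blast
    have "fst x $ w = 0" if "w \<notin> S" for w
    proof (rule euclidean_eqI)
      fix b :: "real^'n" assume b: "b \<in> Basis"
      then have "(axis w b, 0) \<in> Basis" "(axis w b, 0) \<notin> d"
        using that d[of b w] by (auto simp: Basis_prod_def)
      then have "x \<bullet> (axis w b, 0) = 0" by (rule x)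
      then show "(fst x $ w) \<bullet> b = 0 \<bullet> b" by (simp add: inner_prod_def inner_axis)
    qed
    then show "vanishes_off S x" by (simp add: vanishes_off_def)
    show "snd x = 0"
    proof (rule euclidean_eqI)
      fix b :: "real^'k" assume b: "b \<in> Basis"
      then have "(0, b) \<in> Basis" "(0, b) \<notin> d"
        by (auto simp: Basis_prod_def d_def nonzero_Basis)
      then have "x \<bullet> (0, b) = 0" by (rule x)
      then show "snd x \<bullet> b = 0 \<bullet> b" by (simp add: inner_prod_def)
    qed
  qed
  moreover have "d \<subseteq> Basis" by (auto simp: d_def Basis_prod_def)
  moreover have "card d = card S * CARD('n)"
    unfolding d_def by (subst card_image) (auto simp: inj_on_def axis_eq_axis nonzero_Basis card_cartesian_product)
  ultimately show ?thesis
    using dim_substandard[of d] by (simp add: mult.commute)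
qed

context periodic_gains
begin

text \<open>\<open>Q\<close> adds up the coordinates within each component. Rank-nullity is applied
  to \<open>Q\<close> twice, on the span of the edge spaces and on the coordinate space of V(F). The
  two kernels coincide, since the forest edges with identity gain already span the second;
  eliminating the common dimension gives the formula.\<close>

lemma dim_contract:
  fixes tail head :: "'e \<Rightarrow> 'v::finite"
  assumes \<phi>: "\<And>e. e \<in> F \<Longrightarrow> \<phi> e \<in> \<Gamma>"
    and T: "maximal_forest tail head F T" and one: "\<And>e. e \<in> T \<Longrightarrow> \<phi> e = \<one>\<^bsub>euclidean_group\<^esub>"
  shows "dim (\<Union>e\<in>F. edge_U Bs B (tail e) (head e) (\<phi> e)) + CARD('n) * card (edge_components tail head F) =
    CARD('n) * card (ends tail head F) + dim (\<Union>e\<in>F. compressed_U Bs B tail head \<phi> F e)"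
proof -
  let ?V = "ends tail head F" and ?C = "edge_components tail head F" and ?c = "component_of tail head F"
  let ?U = "\<Union>e\<in>F. edge_U Bs B (tail e) (head e) (\<phi> e)"
  let ?Z = "\<lambda>S :: _ set. {x :: (real^'n^_) \<times> (real^'k). vanishes_off S x \<and> snd x = 0}"
  define Q :: "(real^'n^'v) \<times> (real^'k) \<Rightarrow> (real^'n^('v set)) \<times> (real^'k)" where
    "Q = (\<lambda>x. ((\<chi> S. \<Sum>w\<in>{w. ?c w = S}. fst x $ w), snd x))"
  have linQ: "linear Q"
    unfolding Q_def by (rule linearI) (simp_all add: vec_eq_iff sum.distrib sum_distrib_left)
  have Q_axis: "Q (axis w a, y) = (axis (?c w) a, y)" for w a y
    by (auto simp: Q_def vec_eq_iff axis_def if_distrib cong: if_cong)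
  have Q_edge: "Q (edge_vec Bs B i j \<gamma> \<alpha>) = edge_vec Bs B (?c i) (?c j) \<gamma> \<alpha>" for i j \<gamma> \<alpha>
    using linear_diff[OF linQ, of "(axis i \<alpha>, - b_map Bs B \<alpha> (snd \<gamma>))" "(axis j (\<alpha> v* fst \<gamma>), 0)"]
    by (simp add: edge_vec_def Q_axis)
  have QU: "(\<Union>e\<in>F. compressed_U Bs B tail head \<phi> F e) = Q ` ?U"
    unfolding image_UN compressed_U_def
    by (intro SUP_cong HOL.refl) (simp add: edge_U_eq_range[OF orthogonal_\<Gamma>[OF \<phi>]] image_image Q_edge)
  have TF: "T \<subseteq> F" using T by (simp add: maximal_forest_def)
  \<comment> \<open>A forest edge has gain 1, so its vectors are differences of axis vectors with
    star part 0; these telescope along a path in \<open>T\<close>.\<close>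
  have conn_span: "(axis v a - axis w a, 0) \<in> span ?U" if "(v, w) \<in> conn tail head T" for v w a
    using that
  proof (induction rule: rtrancl_induct)
    case base
    show ?case by (simp add: span_zero flip: zero_prod_def)
  next
    case (step x y)
    have e: "(axis (tail e) a - axis (head e) a, 0) \<in> span ?U" if "e \<in> T" for e
    proof (rule span_base)
      have "edge_vec Bs B (tail e) (head e) (\<phi> e) a = (axis (tail e) a - axis (head e) a, 0)"
        by (simp add: edge_vec_def one[OF that] euclidean_group_def b_map_def vec_eq_iff)
      moreover have "e \<in> F" using that TF by blast
      moreover from this have "edge_vec Bs B (tail e) (head e) (\<phi> e) a \<in> edge_U Bs B (tail e) (head e) (\<phi> e)"
        by (simp add: edge_U_eq_range orthogonal_\<Gamma> \<phi>)
      ultimately show "(axis (tail e) a - axis (head e) a, 0) \<in> ?U" by auto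
    qed
    have "(axis x a - axis y a, 0) \<in> span ?U"
      using step(2) e span_neg[OF e] by auto
    from span_add[OF step.IH this] show ?case by simp
  qed
  \<comment> \<open>A representative vertex in each component makes \<open>R\<close> a right inverse
    of \<open>Q\<close> on vectors supported on the components with star part 0. Then x - R (Q x)
    moves each coordinate to its representative along \<open>T\<close>.\<close>
  define \<rho> where "\<rho> = (\<lambda>S. SOME w. w \<in> ?V \<and> ?c w = S)"
  have \<rho>: "\<rho> S \<in> ?V \<and> ?c (\<rho> S) = S" if "S \<in> ?C" for S
    unfolding \<rho>_def by (rule someI_ex) (use that in \<open>auto simp: edge_components_def\<close>)
  define R :: "(real^'n^('v set)) \<times> (real^'k) \<Rightarrow> (real^'n^'v) \<times> (real^'k)" where
    "R = (\<lambda>y. \<Sum>S\<in>?C. (axis (\<rho> S) (fst y $ S), 0))"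
  have linR: "linear R"
    unfolding R_def by (intro linear_compose_sum ballI linearI)
      (simp_all add: linear_add[OF linear_axis] linear_scale[OF linear_axis])
  have R_axis: "R (axis S a, y) = (axis (\<rho> S) a, 0)" if "S \<in> ?C" for S a y
  proof -
    have "R (axis S a, y) = (\<Sum>S'\<in>?C. if S' = S then (axis (\<rho> S) a, 0) else 0)"
      unfolding R_def by (intro sum.cong HOL.refl) (auto simp: axis_def vec_eq_iff prod_eq_iff)
    then show ?thesis using that by simp
  qed
  have Z_sum: "x = (\<Sum>w\<in>S. (axis w (fst x $ w), 0))" if "x \<in> ?Z S" for x and S :: "'w::finite set"
    using that by (auto simp: prod_eq_iff fst_sum snd_sum vec_eq_iff vanishes_off_def axis_def if_distrib sum.delta
        cong: if_cong)
  have "x - R (Q x) \<in> span ?U" if "x \<in> ?Z ?V" for x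
  proof -
    have "x - R (Q x) = (\<Sum>w\<in>?V. (axis w (fst x $ w), 0)) - R (Q (\<Sum>w\<in>?V. (axis w (fst x $ w), 0)))"
      using Z_sum[OF that] by simp
    also have "\<dots> = (\<Sum>w\<in>?V. (axis w (fst x $ w), 0) - R (Q (axis w (fst x $ w), 0)))"
      by (simp only: linear_sum[OF linQ] linear_sum[OF linR] sum_subtractf)
    also have "\<dots> = (\<Sum>w\<in>?V. (axis w (fst x $ w) - axis (\<rho> (?c w)) (fst x $ w), 0))"
      by (intro sum.cong HOL.refl) (simp add: Q_axis R_axis edge_components_def)
    also have "\<dots> \<in> span ?U"
    proof (intro span_sum conn_span subsetD[OF maximal_forest_conn[OF T]])
      fix w assume "w \<in> ?V"
      then show "(w, \<rho> (?c w)) \<in> conn tail head F"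
        using \<rho>[of "?c w"] by (simp add: component_of_eq_iff[symmetric] edge_components_def)
    qed
    finally show ?thesis .
  qed
  then have sub2: "{x \<in> ?Z ?V. Q x = 0} \<subseteq> {x \<in> span ?U. Q x = 0}"
    using linear_0[OF linR] by force
  have "span ?U \<subseteq> {x. vanishes_off ?V x}"
  proof (rule span_minimal)
    show "subspace {x :: (real^'n^'v) \<times> (real^'k). vanishes_off ?V x}"
      by (auto simp: subspace_def vanishes_off_def)
    have "edge_U Bs B (tail e) (head e) (\<phi> e) \<subseteq> {x. vanishes_off ?V x}" if "e \<in> F" for e
      using that unfolding edge_U_eq_range[OF orthogonal_\<Gamma>[OF \<phi>[OF that]]]
      by (auto simp: vanishes_off_def edge_vec_def axis_def ends_def)
    then show "?U \<subseteq> {x. vanishes_off ?V x}" by blast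
  qed
  \<comment> \<open>\<open>Q\<close> copies the star part, so a kernel vector has star part 0, as
    membership in \<open>?Z\<close> demands.\<close>
  then have "{x \<in> span ?U. Q x = 0} \<subseteq> {x \<in> ?Z ?V. Q x = 0}"
    by (auto simp: Q_def prod_eq_iff)
  with sub2 have ker: "{x \<in> span ?U. Q x = 0} = {x \<in> ?Z ?V. Q x = 0}" by (rule equalityI[rotated])
  have subZ: "subspace (?Z S)" for S :: "'w::finite set"
    by (auto simp: subspace_def vanishes_off_def)
  have "Q ` ?Z ?V = ?Z ?C"
  proof (intro equalityI subsetI)
    fix y assume "y \<in> Q ` ?Z ?V"
    then obtain x where x: "x \<in> ?Z ?V" "y = Q x" by blast
    have "fst y $ S = 0" if "S \<notin> ?C" for S
      using x that by (auto simp: Q_def vanishes_off_def edge_components_def intro!: sum.neutral)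
    then show "y \<in> ?Z ?C" using x by (simp add: vanishes_off_def Q_def)
  next
    fix y assume y: "y \<in> ?Z ?C"
    have "Q (R y) = (\<Sum>S\<in>?C. (axis S (fst y $ S), 0))"
      unfolding R_def linear_sum[OF linQ] using \<rho> by (intro sum.cong HOL.refl) (simp add: Q_axis)
    also have "\<dots> = y" using Z_sum[OF y] by simp
    finally have "Q (R y) = y" .
    moreover have "R y \<in> ?Z ?V"
      using \<rho> by (auto simp: R_def vanishes_off_def fst_sum snd_sum axis_def intro!: sum.neutral)
    ultimately show "y \<in> Q ` ?Z ?V" by (rule image_eqI[OF sym])
  qed
  then have "CARD('n) * card ?V = CARD('n) * card ?C + dim {x \<in> ?Z ?V. Q x = 0}"
    using dim_image_kernel[OF linQ subZ[of ?V]] by (simp only: dim_vanishes_off)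
  moreover have "dim ?U = dim (\<Union>e\<in>F. compressed_U Bs B tail head \<phi> F e) + dim {x \<in> ?Z ?V. Q x = 0}"
    using dim_image_kernel[OF linQ subspace_span[of ?U]] unfolding ker QU
    unfolding linear_span_image[OF linQ, symmetric] by simp
  ultimately show ?thesis by simp
qed

lemma h_space_group_eq:
  fixes tail head :: "'e \<Rightarrow> 'v::finite"
  assumes \<psi>: "\<And>e. e \<in> F \<Longrightarrow> \<psi> e \<in> \<Gamma>" and c: "compressed_gain \<Gamma> tail head \<psi> F (\<psi>\<^sub>0 F)"
  shows "h_space_group Bs B tail head \<psi>\<^sub>0 F = int (dim (\<Union>e\<in>F. edge_U Bs B (tail e) (head e) (\<psi> e))) - 1"
proof -
  obtain T where T: "maximal_forest tail head F T" "\<forall>e\<in>T. \<psi>\<^sub>0 F e = \<one>\<^bsub>euclidean_group\<^esub>"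
    and sw: "switchable \<Gamma> tail head \<psi> (\<psi>\<^sub>0 F)"
    using c by (auto simp: compressed_gain_def)
  have s: "(\<forall>e\<in>F. \<psi>\<^sub>0 F e \<in> \<Gamma>) \<and> dim (\<Union>e\<in>F. edge_U Bs B (tail e) (head e) (\<psi>\<^sub>0 F e)) =
      dim (\<Union>e\<in>F. edge_U Bs B (tail e) (head e) (\<psi> e))"
    using switchable_dim[OF sw] \<psi> by blast
  have "dim (\<Union>e\<in>F. edge_U Bs B (tail e) (head e) (\<psi>\<^sub>0 F e)) + CARD('n) * card (edge_components tail head F) =
    CARD('n) * card (ends tail head F) + dim (\<Union>e\<in>F. compressed_U Bs B tail head (\<psi>\<^sub>0 F) F e)"
    by (rule dim_contract[OF _ T(1)]) (use T(2) s in auto)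
  from arg_cong[OF this, of int] show ?thesis
    using s by (simp add: h_space_group_def)
qed

end

section \<open>The action of the commutant of the point group\<close>

definition lattice_comb :: "('k::finite \<Rightarrow> real^'n^'n) \<Rightarrow> real^'k \<Rightarrow> real^'n^'n" where
  "lattice_comb Bs s = (\<Sum>l\<in>UNIV. s $ l *\<^sub>R Bs l)"

lemma linear_lattice_comb: "linear (lattice_comb Bs)"
  by (rule linearI) (simp_all add: lattice_comb_def scaleR_add_left sum.distrib scaleR_right.sum)

lemma linear_matrix_mul_left: "linear (\<lambda>A :: real^'p^'m. (M :: real^'m^'n) ** A)"
  by (rule linearI)
    (simp_all add: matrix_add_ldistrib vec_eq_iff matrix_matrix_mult_def sum_distrib_left mult.left_commute
      sum.distrib distrib_left)

lemma matrix_mul_lattice_comb: "M ** lattice_comb Bs s = (\<Sum>l\<in>UNIV. s $ l *\<^sub>R (M ** Bs l))"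
  by (simp add: lattice_comb_def linear_sum[OF linear_matrix_mul_left] linear_scale[OF linear_matrix_mul_left])

lemma inj_lattice_comb:
  assumes "basis_of Bs S" "lattice_comb Bs s = 0"
  shows "s = 0"
proof -
  have inj: "inj Bs" and ind: "independent (range Bs)" using assms(1) by (auto simp: basis_of_def)
  have "(\<Sum>A\<in>range Bs. (s $ inv_into UNIV Bs A) *\<^sub>R A) = 0"
    using assms(2) by (simp add: lattice_comb_def sum.reindex[OF inj] inv_f_f[OF inj])
  then have "s $ inv_into UNIV Bs (Bs l) = 0" for l
    by (rule independentD[OF ind finite_imageI[OF finite_class.finite_UNIV] subset_refl]) simp
  then show ?thesis by (simp add: vec_eq_iff inv_f_f[OF inj])
qed

lemma range_lattice_comb:
  assumes "basis_of Bs S"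
  shows "range (lattice_comb Bs) = S"
proof -
  have inj: "inj Bs" and S: "span (range Bs) = S" using assms by (auto simp: basis_of_def)
  have "span (range Bs) \<subseteq> range (lattice_comb Bs)"
  proof
    fix A assume "A \<in> span (range Bs)"
    then obtain u where "A = (\<Sum>A\<in>range Bs. u A *\<^sub>R A)"
      unfolding span_finite[OF finite_imageI[OF finite_class.finite_UNIV]] by blast
    then have "A = lattice_comb Bs (\<chi> l. u (Bs l))"
      by (simp add: lattice_comb_def sum.reindex[OF inj])
    then show "A \<in> range (lattice_comb Bs)" by blast
  qed
  moreover have "range (lattice_comb Bs) \<subseteq> span (range Bs)"
    by (auto simp: lattice_comb_def intro!: span_sum span_scale intro: span_base)
  ultimately show ?thesis using S by blast
qed

locale lattice_gains =
  fixes \<Gamma> :: "'n::finite isometry set" and B :: "real^'n^'n" and Bs :: "'k::finite \<Rightarrow> real^'n^'n"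
  assumes space_group_\<Gamma>: "space_group \<Gamma>"
    and lattice_B: "lattice_basis \<Gamma> B"
    and basis_Bs: "basis_of Bs (Lat_bar \<Gamma> B)"
begin

lemma invertible_B: "invertible B"
  using lattice_B by (simp add: lattice_basis_def)

text \<open>\<open>A\<close> intertwines B^-1 A_\<gamma> B with A_\<gamma>; multiplying by B^-1 on
  the right identifies \<open>Lat_bar\<close> with the commutant of the point group.\<close>

lemma Lat_bar_commutes:
  assumes "A \<in> Lat_bar \<Gamma> B" "\<gamma> \<in> \<Gamma>"
  shows "(A ** matrix_inv B) ** fst \<gamma> = fst \<gamma> ** (A ** matrix_inv B)"
proof -
  have "(A ** std_matrix B \<gamma>) ** matrix_inv B = (fst \<gamma> ** A) ** matrix_inv B"
    using assms by (simp add: Lat_bar_def)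
  then have "A ** matrix_inv B ** fst \<gamma> ** (B ** matrix_inv B) = fst \<gamma> ** A ** matrix_inv B"
    by (simp add: std_matrix_def matrix_mul_assoc)
  then show ?thesis by (simp add: matrix_inv_inverse[OF invertible_B] matrix_mul_assoc)
qed

lemma Bs_in_Lat_bar: "Bs l \<in> Lat_bar \<Gamma> B"
  using basis_Bs unfolding basis_of_def by (metis rangeI span_base)

sublocale periodic_gains \<Gamma> B Bs
proof (rule periodic_gains.intro)
  show "subgroup \<Gamma> euclidean_group" using space_group_\<Gamma> by (simp add: space_group_def)
qed (rule Lat_bar_commutes[OF Bs_in_Lat_bar])

lemma commutant_mul_Lat_bar:
  assumes "\<And>\<gamma>. \<gamma> \<in> \<Gamma> \<Longrightarrow> M ** fst \<gamma> = fst \<gamma> ** M" "A \<in> Lat_bar \<Gamma> B"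
  shows "M ** A \<in> Lat_bar \<Gamma> B"
  using assms by (auto simp: Lat_bar_def matrix_mul_assoc[symmetric]) (simp add: matrix_mul_assoc)

text \<open>
  \<open>\<Psi>\<close> is the action of \<open>M\<close> on pairs of a placement and a lattice, and \<open>\<Phi>\<close> its transpose.
\<close>

lemma commutant_action:
  assumes M: "invertible M" and comm: "\<And>\<gamma>. \<gamma> \<in> \<Gamma> \<Longrightarrow> M ** fst \<gamma> = fst \<gamma> ** M"
  obtains \<Psi> \<Phi> :: "(real^'n^'v::finite) \<times> (real^'k) \<Rightarrow> (real^'n^'v) \<times> (real^'k)"
  where "linear \<Phi>" "inj \<Phi>" "\<And>q x. \<Psi> q \<bullet> x = q \<bullet> \<Phi> x"
    and "\<And>p s. fst (\<Psi> (p, s)) = (\<chi> w. M *v (p $ w))"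
    and "\<And>p s. lattice_comb Bs (snd (\<Psi> (p, s))) = M ** lattice_comb Bs s"
    and "\<And>i j \<gamma> x. \<gamma> \<in> \<Gamma> \<Longrightarrow> x \<in> edge_U Bs B i j \<gamma> \<Longrightarrow> \<Phi> x \<in> edge_U Bs B i j \<gamma>"
proof -
  have "\<forall>l. \<exists>c. M ** Bs l = lattice_comb Bs c"
    using commutant_mul_Lat_bar[OF comm Bs_in_Lat_bar] range_lattice_comb[OF basis_Bs] by blast
  then obtain c where c: "\<And>l. M ** Bs l = lattice_comb Bs (c l)" by metis
  \<comment> \<open>\<open>c l\<close> holds the coordinates of \<open>M ** Bs l\<close>, so the
    second component is left multiplication by \<open>M\<close> in lattice coordinates.\<close>
  define \<Psi> :: "(real^'n^'v) \<times> (real^'k) \<Rightarrow> (real^'n^'v) \<times> (real^'k)" where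
    "\<Psi> = (\<lambda>q. (\<chi> w. M *v (fst q $ w), \<Sum>l\<in>UNIV. (snd q $ l) *\<^sub>R c l))"
  define \<Phi> :: "(real^'n^'v) \<times> (real^'k) \<Rightarrow> (real^'n^'v) \<times> (real^'k)" where
    "\<Phi> = (\<lambda>x. (\<chi> w. (fst x $ w) v* M, \<chi> l. c l \<bullet> snd x))"
  have lin\<Phi>: "linear \<Phi>"
    by (rule linearI) (simp_all add: \<Phi>_def vec_eq_iff vector_matrix_left_distrib scaleR_vector_matrix_assoc inner_simps)
  have lin\<Psi>: "linear \<Psi>"
    by (rule linearI) (simp_all add: \<Psi>_def vec_eq_iff matrix_vector_right_distrib matrix_vector_mult_scaleR
       scaleR_add_left sum.distrib scaleR_right.sum sum_distrib_left mult.assoc distrib_right)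
  have adj: "\<Psi> q \<bullet> x = q \<bullet> \<Phi> x" for q x
    by (simp add: \<Psi>_def \<Phi>_def inner_prod_def inner_vec_def[where 'b = 'v] inner_vec_def[of "snd q"] inner_sum_left
        inner_commute[of _ "_ v* M"] dot_lmul_matrix inner_commute[of "M *v _"])
  have lat: "lattice_comb Bs (snd (\<Psi> (p, s))) = M ** lattice_comb Bs s" for p s
    by (simp add: \<Psi>_def linear_sum[OF linear_lattice_comb] linear_scale[OF linear_lattice_comb]
        matrix_mul_lattice_comb c)
  have cancel: "x = 0" if "M *v x = 0" for x
  proof -
    have "matrix_inv M *v (M *v x) = x"
      unfolding matrix_vector_mul_assoc matrix_inv_inverse[OF M] by simp
    then show ?thesis using that by simp
  qed
  have "inj \<Psi>"
    unfolding linear_injective_0[OF lin\<Psi>]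
  proof (intro allI impI)
    fix q assume q: "\<Psi> q = 0"
    have "M *v (fst q $ w) = 0" for w
      using q by (simp add: \<Psi>_def prod_eq_iff vec_eq_iff)
    then have "fst q $ w = 0" for w by (rule cancel)
    moreover have "M ** lattice_comb Bs (snd q) = 0"
      using lat[of "fst q" "snd q", symmetric] q by (simp add: linear_0[OF linear_lattice_comb])
    then have "(matrix_inv M ** M) ** lattice_comb Bs (snd q) = 0"
      by (simp add: matrix_mul_assoc[symmetric] linear_0[OF linear_matrix_mul_left])
    then have "lattice_comb Bs (snd q) = 0" by (simp add: matrix_inv_inverse[OF M])
    then have "snd q = 0" by (rule inj_lattice_comb[OF basis_Bs])
    ultimately show "q = 0" by (simp add: prod_eq_iff vec_eq_iff)
  qed
  then have surj: "surj \<Psi>" by (rule linear_injective_imp_surjective[OF lin\<Psi>]) simp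
  \<comment> \<open>A vector killed by the transpose is orthogonal to the range of \<Psi>, which is
    everything.\<close>
  have "inj \<Phi>"
    unfolding linear_injective_0[OF lin\<Phi>]
  proof (intro allI impI)
    fix x assume "\<Phi> x = 0"
    then have "\<Psi> q \<bullet> x = 0" for q by (simp add: adj)
    then have "x \<bullet> x = 0" using surj by (metis surjD)
    then show "x = 0" by simp
  qed
  moreover have "\<Phi> x \<in> edge_U Bs B i j \<gamma>" if "\<gamma> \<in> \<Gamma>" "x \<in> edge_U Bs B i j \<gamma>" for i j \<gamma> x
  proof -
    note range = edge_U_eq_range[OF orthogonal_\<Gamma>[OF that(1)]]
    from that(2) obtain \<alpha> where \<alpha>: "x = edge_vec Bs B i j \<gamma> \<alpha>"
      unfolding range by blast
    have "(c l \<bullet> b_map Bs B \<alpha> t) = b_map Bs B (\<alpha> v* M) t $ l" for l t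
    proof -
      have "M *v ((Bs l ** matrix_inv B) *v t) = lattice_comb Bs (c l) *v (matrix_inv B *v t)"
        by (simp add: matrix_vector_mul_assoc matrix_mul_assoc c)
      also have "\<dots> = (\<Sum>m\<in>UNIV. (c l $ m) *\<^sub>R ((Bs m ** matrix_inv B) *v t))"
        unfolding lattice_comb_def linear_sum[OF linear_matrix_vector]
        by (simp add: scaleR_matrix_vector_assoc matrix_vector_mul_assoc[symmetric])
      finally show ?thesis
        by (simp add: b_map_def inner_vec_def[of "c l"] dot_lmul_matrix inner_sum_right)
    qed
    \<comment> \<open>Commuting with the point group lets the head coordinate follow: the image is
      again an edge vector with the same gain, with parameter \<open>\<alpha> v* M\<close>.\<close>
    moreover have "(\<alpha> v* fst \<gamma>) v* M = (\<alpha> v* M) v* fst \<gamma>"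
      by (simp add: vector_matrix_mul_assoc comm[OF that(1)])
    ultimately have "\<Phi> x = edge_vec Bs B i j \<gamma> (\<alpha> v* M)"
      unfolding \<alpha> by (simp add: \<Phi>_def edge_vec_def vec_eq_iff axis_def vector_matrix_mult_diff_distrib
          linear_0[OF linear_vector_matrix])
    then show ?thesis using edge_U_eq_range[OF orthogonal_\<Gamma>[OF that(1)]] by blast
  qed
  moreover have "fst (\<Psi> (p, s)) = (\<chi> w. M *v (p $ w))" for p s by (simp add: \<Psi>_def)
  ultimately show ?thesis using that[OF lin\<Phi>] adj lat by blast
qed

text \<open>The line passes through \<open>B\<close> at \<tau> = 1, so after multiplication by B^-1
  it is a pencil 1 + (1 - \<tau>) T.\<close>

lemma finite_singular_lattice_comb:
  assumes s: "lattice_comb Bs s = B"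
  shows "finite {\<tau>. \<not> invertible (lattice_comb Bs (s' + \<tau> *\<^sub>R (s - s')))}"
proof -
  let ?L = "lattice_comb Bs (s' - s)" and ?N = "\<lambda>\<tau>. lattice_comb Bs (s' + \<tau> *\<^sub>R (s - s'))"
  let ?T = "\<lambda>x. (matrix_inv B ** ?L) *v x"
  have "invertible (?N \<tau>)" if inj: "inj (\<lambda>x. x + (1 - \<tau>) *\<^sub>R ?T x)" for \<tau>
  proof -
    have "s' + \<tau> *\<^sub>R (s - s') = s + (1 - \<tau>) *\<^sub>R (s' - s)" by (simp add: algebra_simps)
    then have N: "?N \<tau> = B + (1 - \<tau>) *\<^sub>R ?L"
      using s by (simp add: linear_add[OF linear_lattice_comb] linear_scale[OF linear_lattice_comb])
    have "x + (1 - \<tau>) *\<^sub>R ?T x = (matrix_inv B ** ?N \<tau>) *v x" for x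
      unfolding N
      by (simp add: matrix_add_ldistrib matrix_inv_inverse[OF invertible_B] matrix_vector_mult_add_rdistrib
          scaleR_matrix_vector_assoc linear_scale[OF linear_matrix_mul_left])
    then have "inj ((*v) (matrix_inv B ** ?N \<tau>))" using inj by simp
    then have "invertible (matrix_inv B ** ?N \<tau>)"
      using matrix_left_invertible_injective[of "matrix_inv B ** ?N \<tau>"] by (simp add: invertible_left_inverse)
    moreover have "B ** (matrix_inv B ** ?N \<tau>) = ?N \<tau>"
      by (simp add: matrix_mul_assoc matrix_inv_inverse[OF invertible_B])
    ultimately show ?thesis using invertible_mult[OF invertible_B] by metis
  qed
  then have "{\<tau>. \<not> invertible (?N \<tau>)} \<subseteq> (\<lambda>\<sigma>. 1 - \<sigma>) ` {\<sigma>. \<not> inj (\<lambda>x. x + \<sigma> *\<^sub>R ?T x)}"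
    by (force intro!: image_eqI[of _ _ "1 - _"])
  then show ?thesis
    by (rule finite_subset) (intro finite_imageI finite_noninjective_pencil matrix_vector_mul_linear)
qed

text \<open>
  The commutant moves a pair of a placement and a lattice of maximal dimension to a pair over \<open>B\<close>.
\<close>

lemma AE_dim_gen_span_max:
  fixes G :: "((real^'n^'v::finite) \<times> (real^'k) \<Rightarrow> (real^'n^'v) \<times> (real^'k)) set"
  assumes lin: "\<And>g. g \<in> G \<Longrightarrow> linear g" and s: "lattice_comb Bs s = B"
    and equi: "\<And>g \<Phi> \<Psi>. g \<in> G \<Longrightarrow> linear \<Phi> \<Longrightarrow> (\<And>q x. \<Psi> q \<bullet> x = q \<bullet> \<Phi> x) \<Longrightarrow>
      (\<And>i j \<gamma> x. \<gamma> \<in> \<Gamma> \<Longrightarrow> x \<in> edge_U Bs B i j \<gamma> \<Longrightarrow> \<Phi> x \<in> edge_U Bs B i j \<gamma>) \<Longrightarrow>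
      \<exists>g'\<in>G. \<forall>q. \<Phi> (g (\<Psi> q)) = g' q"
  shows "AE p in lborel. \<forall>q. dim (gen_span G q) \<le> dim (gen_span G (p, s))"
proof -
  have "\<exists>q0. \<forall>q. dim (gen_span G q) \<le> dim (gen_span G q0)"
    using ex_has_greatest_nat[of "\<lambda>_. True" undefined "\<lambda>q. dim (gen_span G q)" "Suc DIM((real^'n^'v) \<times> (real^'k))"]
    by (simp only: less_Suc_eq_le dim_subset_UNIV simp_thms)
  then obtain q0 where q0: "\<And>q. dim (gen_span G q) \<le> dim (gen_span G q0)" by blast
  obtain p0 s' where ps: "q0 = (p0, s')" by (cases q0)
  \<comment> \<open>The maximizer may have a singular lattice. Moving its lattice part towards
    \<open>s\<close> keeps the dimension and gives an invertible lattice, except for finitely many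
    \<tau>.\<close>
  have "finite ({\<tau>. dim (gen_span G (q0 + \<tau> *\<^sub>R (0, s - s'))) < dim (gen_span G q0)} \<union>
      {\<tau>. \<not> invertible (lattice_comb Bs (s' + \<tau> *\<^sub>R (s - s')))})"
    by (intro finite_UnI finite_dim_gen_span_drop lin finite_singular_lattice_comb s)
  from ex_new_if_finite[OF infinite_UNIV_char_0 this]
  obtain \<tau> where \<tau>: "dim (gen_span G q0) \<le> dim (gen_span G (q0 + \<tau> *\<^sub>R (0, s - s')))"
    "invertible (lattice_comb Bs (s' + \<tau> *\<^sub>R (s - s')))"
    by (auto simp: not_less simp del: scaleR_Pair)
  define s1 where "s1 = s' + \<tau> *\<^sub>R (s - s')"
  have max1: "dim (gen_span G q) \<le> dim (gen_span G (p0, s1))" for q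
    using q0[of q] \<tau>(1) by (simp add: ps s1_def)
  \<comment> \<open>\<open>M\<close> carries \<open>B\<close> to the lattice with coordinates
    \<open>s1\<close>, and it lies in the commutant because that lattice is in
    \<open>Lat_bar\<close>.\<close>
  define M where "M = lattice_comb Bs s1 ** matrix_inv B"
  have inv1: "invertible (lattice_comb Bs s1)" using \<tau>(2) by (simp add: s1_def)
  have "invertible (matrix_inv B)"
    using matrix_inv_inverse[OF invertible_B] by (auto simp: invertible_def)
  then have M: "invertible M" unfolding M_def by (rule invertible_mult[OF inv1])
  have comm: "M ** fst \<gamma> = fst \<gamma> ** M" if "\<gamma> \<in> \<Gamma>" for \<gamma>
    unfolding M_def using range_lattice_comb[OF basis_Bs] that by (intro Lat_bar_commutes) auto
  obtain \<Psi> \<Phi> :: "(real^'n^'v) \<times> (real^'k) \<Rightarrow> (real^'n^'v) \<times> (real^'k)"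
    where \<Phi>: "linear \<Phi>" "inj \<Phi>" and adj: "\<And>q x. \<Psi> q \<bullet> x = q \<bullet> \<Phi> x"
    and \<Psi>: "\<And>p s. fst (\<Psi> (p, s)) = (\<chi> w. M *v (p $ w))"
      "\<And>p s. lattice_comb Bs (snd (\<Psi> (p, s))) = M ** lattice_comb Bs s"
    and U: "\<And>i j \<gamma> x. \<gamma> \<in> \<Gamma> \<Longrightarrow> x \<in> edge_U Bs B i j \<gamma> \<Longrightarrow> \<Phi> x \<in> edge_U Bs B i j \<gamma>"
    by (rule commutant_action[OF M comm]) (assumption | blast)+
  define p1 where "p1 = (\<chi> w. matrix_inv M *v (p0 $ w))"
  have "\<Psi> (p1, s) = (p0, s1)"
  proof (rule prod_eqI)
    show "fst (\<Psi> (p1, s)) = fst (p0, s1)"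
      by (simp add: \<Psi> p1_def vec_eq_iff matrix_vector_mul_assoc matrix_inv_inverse[OF M])
    have "lattice_comb Bs (snd (\<Psi> (p1, s))) = lattice_comb Bs s1 ** (matrix_inv B ** B)"
      by (simp add: \<Psi> s M_def matrix_mul_assoc)
    then have "lattice_comb Bs (snd (\<Psi> (p1, s)) - s1) = 0"
      by (simp add: linear_diff[OF linear_lattice_comb] matrix_inv_inverse[OF invertible_B])
    from inj_lattice_comb[OF basis_Bs this] show "snd (\<Psi> (p1, s)) = snd (p0, s1)" by simp
  qed
  \<comment> \<open>By equivariance the injective \<Phi> maps the span at \<Psi> q into the span at
    \<open>q\<close>, so the maximum at (p0, s1) is inherited by (p1, s).\<close>
  moreover have "dim (gen_span G (\<Psi> q)) \<le> dim (gen_span G q)" for q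
  proof (rule dim_le_inj_linear[OF \<Phi>])
    fix x assume "x \<in> gen_span G (\<Psi> q)"
    then show "\<Phi> x \<in> gen_span G q"
      unfolding gen_span_def
    proof (induction rule: span_induct_alt)
      case base
      then show ?case by (simp add: linear_0[OF \<Phi>(1)] span_zero)
    next
      case (step c x y)
      then obtain g where g: "g \<in> G" "x = g (\<Psi> q)" by blast
      have "\<exists>g'\<in>G. \<forall>q. \<Phi> (g (\<Psi> q)) = g' q"
        by (rule equi[OF g(1) \<Phi>(1) adj U])
      then obtain g' where "g' \<in> G" "\<Phi> x = g' q" using g(2) by blast
      then have "\<Phi> x \<in> (\<lambda>g. g q) ` G" by simp
      then show ?case
        using step(2) by (simp add: linear_add[OF \<Phi>(1)] linear_scale[OF \<Phi>(1)] span_add span_scale span_base)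
    qed
  qed
  ultimately have max2: "dim (gen_span G q) \<le> dim (gen_span G (p1, s))" for q
    using order_trans[OF max1[of q]] by metis
  \<comment> \<open>With \<open>s\<close> fixed, good placements form an open set that every line
    through \<open>p1\<close> leaves at finitely many points only.\<close>
  let ?O = "{p. dim (gen_span G (p1, s)) \<le> dim (gen_span G (p, s))}"
  have "AE p in lborel. p \<in> ?O"
  proof (rule AE_lborel_radial[where a = p1])
    have "open ((\<lambda>p. (p, s)) -` {q. dim (gen_span G (p1, s)) \<le> dim (gen_span G q)})"
      by (intro open_vimage open_dim_gen_span lin continuous_intros)
    then show "open ?O" by (simp add: vimage_def)
    show "finite {\<tau>. p1 + \<tau> *\<^sub>R x \<notin> ?O}" for x
      using finite_dim_gen_span_drop[of G "(p1, s)" "(x, 0)"] lin by (simp add: not_le)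
  qed
  then show ?thesis
    by eventually_elim (use max2 le_trans in blast)
qed

end

section \<open>Assembly of the truncation formula\<close>

lemma dilworth_truncation_eqI:
  assumes "finite F" and Fp: "Fp = {e \<in> F. 0 \<le> h {e}}" and "Fp = {} \<Longrightarrow> m = 0"
    and le: "\<And>P. partition_on Fp P \<Longrightarrow> m \<le> (\<Sum>X\<in>P. h X)"
    and ge: "\<exists>P. partition_on Fp P \<and> (\<Sum>X\<in>P. h X) \<le> m"
  shows "dilworth_truncation h F = m"
proof (cases "Fp = {}")
  case True
  then show ?thesis using assms(3) by (simp add: dilworth_truncation_def Fp[symmetric])
next
  case False
  have "finite {P. partition_on Fp P}"
    using assms(1) Fp by (intro finitely_many_partition_on) auto
  then have "finite {(\<Sum>X\<in>P. h X) | P. partition_on Fp P}" by simp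
  moreover obtain P where "partition_on Fp P" "(\<Sum>X\<in>P. h X) = m"
    using ge le by (metis order_antisym)
  ultimately have "Min {(\<Sum>X\<in>P. h X) | P. partition_on Fp P} = m"
    using le by (intro Min_eqI) auto
  then show ?thesis using False by (simp add: dilworth_truncation_def Fp[symmetric])
qed

theorem theorem10p5:
  fixes \<Gamma> :: "'n::finite isometry set"
    and B\<^sub>\<Gamma> :: "real^'n^'n"
    and Bs :: "'k::finite \<Rightarrow> real^'n^'n"
    and tail head :: "'e \<Rightarrow> 'v::finite"
    and E :: "'e set"
    and \<psi> :: "'e \<Rightarrow> 'n isometry"
    and \<psi>\<^sub>0 :: "'e set \<Rightarrow> 'e \<Rightarrow> 'n isometry"
  assumes "space_group \<Gamma>"
    and "lattice_basis \<Gamma> B\<^sub>\<Gamma>"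
    and "basis_of Bs (Lat_bar \<Gamma> B\<^sub>\<Gamma>)"
    and "generic_lattice \<Gamma> B\<^sub>\<Gamma> Bs"
    and "finite E"
    and "\<And>e. e \<in> E \<Longrightarrow> \<psi> e \<in> \<Gamma>"
    and "\<And>F. F \<subseteq> E \<Longrightarrow> compressed_gain \<Gamma> tail head \<psi> F (\<psi>\<^sub>0 F)"
  shows "AE p in (lborel :: (real^'n^'v) measure).
           int (dim (span (\<Union>e\<in>E. edge_P Bs B\<^sub>\<Gamma> (tail e) (head e) (\<psi> e) p)))
           = dilworth_truncation (h_space_group Bs B\<^sub>\<Gamma> tail head \<psi>\<^sub>0) E"
proof -
  interpret lattice_gains \<Gamma> B\<^sub>\<Gamma> Bs
    by (rule lattice_gains.intro[OF assms(1-3)])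
  note orth = orthogonal_\<Gamma>[OF assms(6)]
  define U where "U = (\<lambda>e. edge_U Bs B\<^sub>\<Gamma> (tail e) (head e) (\<psi> e))"
  let ?h = "h_space_group Bs B\<^sub>\<Gamma> tail head \<psi>\<^sub>0"
  have "B\<^sub>\<Gamma> \<in> Lat_bar \<Gamma> B\<^sub>\<Gamma>"
    by (simp add: Lat_bar_def std_matrix_def matrix_mul_assoc matrix_inv_inverse[OF invertible_B])
  then obtain s where s: "lattice_comb Bs s = B\<^sub>\<Gamma>"
    unfolding range_lattice_comb[OF assms(3), symmetric] by blast
  have subU: "subspace (U e)" if "e \<in> E" for e
    unfolding U_def edge_U_eq_range[OF orth[OF that]]
    by (rule linear_subspace_image[OF linear_edge_vec subspace_UNIV])
  have P: "edge_P Bs B\<^sub>\<Gamma> (tail e) (head e) (\<psi> e) p = U e \<inter> {x. (p, s) \<bullet> x = 0}" if "e \<in> E" for e p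
    unfolding U_def by (rule edge_P_eq[OF orth[OF that] s[unfolded lattice_comb_def, symmetric] invertible_B])
  have h: "?h F = int (dim (\<Union>e\<in>F. U e)) - 1" if "F \<subseteq> E" for F
    unfolding U_def using that assms(6,7) by (intro h_space_group_eq) auto
  \<comment> \<open>Since \<open>?h {e}\<close> is dim (U e) - 1, these are the edges with nonzero
    \<open>U e\<close>, the ones on which q . u e = 1 can be achieved.\<close>
  define Ep where "Ep = {e \<in> E. 0 \<le> ?h {e}}"
  have fin: "finite Ep" using assms(5) by (simp add: Ep_def)
  have EpE: "e \<in> E" if "e \<in> Ep" for e using that by (simp add: Ep_def)
  have Ep_iff: "e \<in> Ep \<longleftrightarrow> \<not> U e \<subseteq> {0}" if "e \<in> E" for e
  proof -
    have "e \<in> Ep \<longleftrightarrow> dim (U e) \<noteq> 0"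
      using that h[of "{e}"] by (auto simp: Ep_def simp del: dim_eq_0)
    then show ?thesis by (simp only: dim_eq_0)
  qed
  have U\<Phi>: "\<Phi> x \<in> U e" if "e \<in> Ep" "x \<in> U e"
    "\<And>i j \<gamma> x. \<gamma> \<in> \<Gamma> \<Longrightarrow> x \<in> edge_U Bs B\<^sub>\<Gamma> i j \<gamma> \<Longrightarrow> \<Phi> x \<in> edge_U Bs B\<^sub>\<Gamma> i j \<gamma>"
    for \<Phi> :: "(real^'n^'v) \<times> (real^'k) \<Rightarrow> (real^'n^'v) \<times> (real^'k)" and e x
    using that EpE assms(6) unfolding U_def by blast
  \<comment> \<open>Index sets \<open>S\<close> of pairs of edges cover both the diagonal family and
    its enlargements by one mixed pair.\<close>
  have AE_cross: "AE p in lborel. \<forall>q. dim (gen_span (cross_maps D) q) \<le> dim (gen_span (cross_maps D) (p, s))"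
    if D: "\<exists>S\<subseteq>Ep \<times> Ep. D = (\<Union>(e, f)\<in>S. U e \<times> U f)" for D
  proof (rule AE_dim_gen_span_max[OF linear_cross_maps s])
    fix g and \<Phi> \<Psi> :: "(real^'n^'v) \<times> (real^'k) \<Rightarrow> (real^'n^'v) \<times> (real^'k)"
    assume g: "g \<in> cross_maps D" and \<Phi>: "linear \<Phi>" "\<And>q x. \<Psi> q \<bullet> x = q \<bullet> \<Phi> x"
      "\<And>i j \<gamma> x. \<gamma> \<in> \<Gamma> \<Longrightarrow> x \<in> edge_U Bs B\<^sub>\<Gamma> i j \<gamma> \<Longrightarrow> \<Phi> x \<in> edge_U Bs B\<^sub>\<Gamma> i j \<gamma>"
    obtain x y where xy: "(x, y) \<in> D" "g = cross_map x y" using g by (auto simp: cross_maps_def)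
    have "\<Phi> z \<in> U e" if "e \<in> Ep" "z \<in> U e" for e z
      using U\<Phi>[OF that \<Phi>(3)] by assumption
    then have "(\<Phi> x, \<Phi> y) \<in> D" using D xy(1) by blast
    moreover have "\<Phi> (g (\<Psi> q)) = cross_map (\<Phi> x) (\<Phi> y) q" for q
      by (simp add: xy(2) cross_map_def linear_diff[OF \<Phi>(1)] linear_scale[OF \<Phi>(1)] \<Phi>(2))
    ultimately show "\<exists>g'\<in>cross_maps D. \<forall>q. \<Phi> (g (\<Psi> q)) = g' q"
      by (auto simp: cross_maps_def intro!: bexI[of _ "(\<Phi> x, \<Phi> y)"])
  qed
  have AE_nz: "AE p in lborel. \<exists>x\<in>U e. (p, s) \<bullet> x \<noteq> 0" if e: "e \<in> Ep" for e
  proof -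
    \<comment> \<open>At \<open>q\<close> this family vanishes exactly when \<open>q\<close> is
      orthogonal to \<open>U e\<close>. It does not vanish at a nonzero x in \<open>U e\<close>, so
      maximal dimension excludes orthogonality.\<close>
    define G where "G = (\<lambda>(x, y) q. (q \<bullet> x) *\<^sub>R y) ` (U e \<times> U e)"
    have "AE p in lborel. \<forall>q. dim (gen_span G q) \<le> dim (gen_span G (p, s))"
    proof (rule AE_dim_gen_span_max[OF _ s])
      show "linear g" if "g \<in> G" for g
      proof -
        have "linear (\<lambda>q. (q \<bullet> x) *\<^sub>R y)" for x y :: "(real^'n^'v) \<times> (real^'k)"
          by (rule linearI) (simp_all add: inner_add_left scaleR_add_left)
        moreover obtain x y where "g = (\<lambda>q. (q \<bullet> x) *\<^sub>R y)" using \<open>g \<in> G\<close> by (auto simp: G_def)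
        ultimately show ?thesis by simp
      qed
    next
      fix g and \<Phi> \<Psi> :: "(real^'n^'v) \<times> (real^'k) \<Rightarrow> (real^'n^'v) \<times> (real^'k)"
      assume g: "g \<in> G" and \<Phi>: "linear \<Phi>" "\<And>q x. \<Psi> q \<bullet> x = q \<bullet> \<Phi> x"
        "\<And>i j \<gamma> x. \<gamma> \<in> \<Gamma> \<Longrightarrow> x \<in> edge_U Bs B\<^sub>\<Gamma> i j \<gamma> \<Longrightarrow> \<Phi> x \<in> edge_U Bs B\<^sub>\<Gamma> i j \<gamma>"
      obtain x y where xy: "x \<in> U e" "y \<in> U e" "g = (\<lambda>q. (q \<bullet> x) *\<^sub>R y)" using g by (auto simp: G_def)
      have "\<Phi> z \<in> U e" if "z \<in> U e" for z
        using U\<Phi>[OF e that \<Phi>(3)] by assumption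
      then have "\<Phi> x \<in> U e" "\<Phi> y \<in> U e" using xy by blast+
      then have "(\<lambda>q. (q \<bullet> \<Phi> x) *\<^sub>R \<Phi> y) \<in> G" by (auto simp: G_def intro!: image_eqI[of _ _ "(\<Phi> x, \<Phi> y)"])
      then show "\<exists>g'\<in>G. \<forall>q. \<Phi> (g (\<Psi> q)) = g' q"
        by (rule bexI[rotated]) (simp add: xy(3) linear_scale[OF \<Phi>(1)] \<Phi>(2))
    qed
    then show ?thesis
    proof eventually_elim
      case (elim p)
      obtain x where x: "x \<in> U e" "x \<noteq> 0" using e Ep_iff[OF EpE[OF e]] by blast
      have "(x \<bullet> x) *\<^sub>R x \<in> gen_span G x"
        unfolding gen_span_def using x(1) by (intro span_base) (auto simp: G_def image_image intro!: image_eqI[of _ _ "(x, x)"])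
      then have "dim (gen_span G x) \<noteq> 0" using x(2) by (auto simp: dim_eq_0)
      then have "dim (gen_span G (p, s)) \<noteq> 0" using elim[rule_format, of x] by linarith
      then have "\<not> (\<lambda>g. g (p, s)) ` G \<subseteq> {0}"
        by (simp add: gen_span_def dim_eq_0)
      then obtain g where "g \<in> G" "g (p, s) \<noteq> 0" by blast
      then obtain x y where "x \<in> U e" "g = (\<lambda>q. (q \<bullet> x) *\<^sub>R y)" by (auto simp: G_def)
      with \<open>g (p, s) \<noteq> 0\<close> show ?case by (intro bexI[of _ x]) auto
    qed
  qed
  have "AE p in lborel. \<forall>q. dim (gen_span (cross_maps (pairs_within U Ep)) q) \<le>
      dim (gen_span (cross_maps (pairs_within U Ep)) (p, s))"
    by (rule AE_cross) (auto simp: pairs_within_def intro!: exI[of _ "(\<lambda>e. (e, e)) ` Ep"])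
  moreover have "AE p in lborel. \<forall>(e, f)\<in>Ep \<times> Ep. \<forall>q. dim (gen_span (cross_maps (pairs_within U Ep \<union> U e \<times> U f)) q) \<le>
      dim (gen_span (cross_maps (pairs_within U Ep \<union> U e \<times> U f)) (p, s))"
  proof (rule AE_finite_allI)
    fix ef assume "ef \<in> Ep \<times> Ep"
    then obtain e f where "ef = (e, f)" "e \<in> Ep" "f \<in> Ep" by blast
    then have "AE p in lborel. \<forall>q. dim (gen_span (cross_maps (pairs_within U Ep \<union> U e \<times> U f)) q) \<le>
      dim (gen_span (cross_maps (pairs_within U Ep \<union> U e \<times> U f)) (p, s))"
      by (intro AE_cross) (auto simp: pairs_within_def intro!: exI[of _ "insert (e, f) ((\<lambda>e. (e, e)) ` Ep)"])
    then show "AE p in lborel. case ef of (e, f) \<Rightarrow> \<forall>q. dim (gen_span (cross_maps (pairs_within U Ep \<union> U e \<times> U f)) q) \<le>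
      dim (gen_span (cross_maps (pairs_within U Ep \<union> U e \<times> U f)) (p, s))"
      using \<open>ef = (e, f)\<close> by simp
  qed (use fin in simp)
  moreover have "AE p in lborel. \<forall>e\<in>Ep. \<exists>x\<in>U e. (p, s) \<bullet> x \<noteq> 0"
    by (rule AE_finite_allI[OF fin AE_nz])
  ultimately show ?thesis
  proof eventually_elim
    case (elim p)
    have "\<exists>x. x \<in> U e \<and> (p, s) \<bullet> x = 1" if e: "e \<in> Ep" for e
    proof -
      obtain x where "x \<in> U e" "(p, s) \<bullet> x \<noteq> 0" using elim(3) e by blast
      then show ?thesis
        using subspace_mul[OF subU[OF EpE[OF e]]] by (intro exI[of _ "(1 / ((p, s) \<bullet> x)) *\<^sub>R x"]) simp
    qed
    then have "\<forall>e\<in>Ep. \<exists>x. x \<in> U e \<and> (p, s) \<bullet> x = 1" by blast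
    from bchoice[OF this] obtain u where u: "\<And>e. e \<in> Ep \<Longrightarrow> u e \<in> U e \<and> (p, s) \<bullet> u e = 1" by blast
    interpret generic_section Ep U "(p, s)" u
      by unfold_locales (use fin subU EpE u elim in auto)
    have "span (\<Union>e\<in>E. edge_P Bs B\<^sub>\<Gamma> (tail e) (head e) (\<psi> e) p) = W"
    proof (rule equalityI)
      \<comment> \<open>An edge outside \<open>Ep\<close> has zero \<open>U e\<close>, so its
        section adds nothing to the span.\<close>
      have "edge_P Bs B\<^sub>\<Gamma> (tail e) (head e) (\<psi> e) p \<subseteq> W" if "e \<in> E" for e
        using P[OF that, of p] Ep_iff[OF that] H_sub_W[of e] subspace_0[OF subspace_W]
        by (cases "e \<in> Ep") (auto simp: H_def)
      then show "span (\<Union>e\<in>E. edge_P Bs B\<^sub>\<Gamma> (tail e) (head e) (\<psi> e) p) \<subseteq> W"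
        by (intro span_minimal subspace_W) blast
      show "W \<subseteq> span (\<Union>e\<in>E. edge_P Bs B\<^sub>\<Gamma> (tail e) (head e) (\<psi> e) p)"
        unfolding W_def by (intro span_mono UN_mono) (use P EpE in \<open>auto simp: H_def\<close>)
    qed
    moreover have "dilworth_truncation ?h E = int (dim W)"
    proof (rule dilworth_truncation_eqI[OF assms(5) Ep_def])
      show "int (dim W) = 0" if "Ep = {}" unfolding W_def using that by simp
      have hP: "(\<Sum>X\<in>Q. ?h X) = (\<Sum>X\<in>Q. int (dim (\<Union>e\<in>X. U e)) - 1)" if "partition_on Ep Q" for Q
        using that EpE by (intro sum.cong HOL.refl h) (auto simp: partition_on_def)
      show "int (dim W) \<le> (\<Sum>X\<in>Q. ?h X)" if "partition_on Ep Q" for Q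
        using dim_W_le[OF that] hP[OF that] by simp
      show "\<exists>Q. partition_on Ep Q \<and> (\<Sum>X\<in>Q. ?h X) \<le> int (dim W)"
        using partition_cls hP[OF partition_cls] dim_W_ge by auto
    qed
    ultimately show ?case by simp
  qed
qed

end
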